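(* Suppose that $X$ is a Banach space with cotype 2. Then $X$ has the $\mathcal K_{up}$-approximation property for all $1\le p<2$.
   Context: All Banach spaces are over the same, either real or complex, scalar field. $B_X$ denotes the closed unit ball of $X$, and $p'$ the dual exponent of $p$ ($1/p+1/p'=1$). $\mathcal L(X,Y)$ denotes the bounded linear operators and $\mathcal F(X,Y)$ the bounded finite-rank operators $X\to Y$. For $1\le p<\infty$, $\ell^p_w(X)$ is the space of weakly $p$-summable sequences $(x_k)$ in $X$, with norm $\|(x_k)\|_{p,w}=\sup_{x^*\in B_{X^*}}\big(\sum_{k}|x^*(x_k)|^p\big)^{1/p}$. A sequence $(x_k)\in\ell^p_w(X)$ is unconditionally $p$-summable, written $(x_k)\in\ell^p_u(X)$, if $\lim_{k\to\infty}\|(0,\ldots,0,x_k,x_{k+1},\ldots)\|_{p,w}=0$. The $p$-convex hull of $(x_k)\in\ell^p_w(X)$ is $p\text{-co}\{x_k\}=\{\sum_{k=1}^\infty\lambda_kx_k\mid(\lambda_k)\in B_{\ell^{p'}}\}$, where $B_{\ell^{p'}}$ is replaced by $B_{c_0}$ if $p=1$. An operator $T\in\mathcal L(X,Y)$ is unconditionally $p$-compact, $T\in\mathcal K_{up}(X,Y)$, if $T(B_X)\subset p\text{-co}\{y_k\}$ for some $(y_k)\in\ell^p_u(Y)$. Its norm is $\|T\|_{\mathcal K_{up}}=\inf\|(y_k)\|_{p,w}$, the infimum being over all such $(y_k)\in\ell^p_u(Y)$. With this norm $\mathcal K_{up}$ is a Banach operator ideal. A Banach space $X$ has the $\mathcal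 K_{up}$-approximation property if for every Banach space $Y$ the space $\mathcal F(Y,X)$ is dense in $\mathcal K_{up}(Y,X)$ with respect to $\|\cdot\|_{\mathcal K_{up}}$. *)

theory Defs
  imports "HOL-Analysis.Analysis"
begin

text \<open>
  The common scalar field: a normed field that is either the reals or the complex numbers.
  (A multiplicative norm extending the absolute value of the reals is determined on the
  complex numbers, so the two cases are exact up to isometric isomorphism.)
\<close>

class real_or_complex_field = real_normed_field + banach +
  assumes real_or_complex:
    "(\<forall>z. \<exists>a. z = a *\<^sub>R 1) \<or>
     (\<exists>i. i * i = - 1 \<and> (\<forall>z. \<exists>a b. z = a *\<^sub>R 1 + b *\<^sub>R i))"

instance real :: real_or_complex_field
  by standard simp

instance complex :: real_or_complex_field
proof
  have "z = Re z *\<^sub>R 1 + Im z *\<^sub>R \<i>" for z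
    by (simp add: complex_eq_iff)
  then show "(\<forall>z::complex. \<exists>a. z = a *\<^sub>R 1) \<or>
     (\<exists>i::complex. i * i = - 1 \<and> (\<forall>z. \<exists>a b. z = a *\<^sub>R 1 + b *\<^sub>R i))"
    by (intro disjI2 exI[of _ \<i>]) auto
qed

text \<open>
  The library's Banach spaces are real. A Banach space over \<open>'k\<close> is such a space together with a
  scalar multiplication by \<open>'k\<close> that extends the real one and for which the norm is homogeneous.
\<close>

locale banach_over = vector_space scale
  for scale :: "'k::real_or_complex_field \<Rightarrow> 'x::banach \<Rightarrow> 'x" +
  assumes scale_of_real: "scale (of_real r) x = r *\<^sub>R x"
    and norm_scale: "norm (scale c x) = norm c * norm x"

definition bounded_operators ::
    "('k::real_or_complex_field \<Rightarrow> 'x::banach \<Rightarrow> 'x) \<Rightarrow> ('k \<Rightarrow> 'y::banach \<Rightarrow> 'y) \<Rightarrow> ('x \<Rightarrow> 'y) set" where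
  "bounded_operators sX sY = {T. bounded_linear T \<and> Vector_Spaces.linear sX sY T}"

definition finite_rank_operators ::
    "('k::real_or_complex_field \<Rightarrow> 'x::banach \<Rightarrow> 'x) \<Rightarrow> ('k \<Rightarrow> 'y::banach \<Rightarrow> 'y) \<Rightarrow> ('x \<Rightarrow> 'y) set" where
  "finite_rank_operators sX sY =
     {T \<in> bounded_operators sX sY. \<exists>B. finite B \<and> range T \<subseteq> module.span sY B}"

definition dual_space ::
    "('k::real_or_complex_field \<Rightarrow> 'x::banach \<Rightarrow> 'x) \<Rightarrow> ('x \<Rightarrow> 'k) set" where
  "dual_space sX = bounded_operators sX (*)"

definition dual_ball ::
    "('k::real_or_complex_field \<Rightarrow> 'x::banach \<Rightarrow> 'x) \<Rightarrow> ('x \<Rightarrow> 'k) set" where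
  "dual_ball sX = {f \<in> dual_space sX. onorm f \<le> 1}"

definition weak_norm ::
    "real \<Rightarrow> ('k::real_or_complex_field \<Rightarrow> 'x::banach \<Rightarrow> 'x) \<Rightarrow> (nat \<Rightarrow> 'x) \<Rightarrow> real" where
  "weak_norm p sX x = (SUP f\<in>dual_ball sX. (\<Sum>k. norm (f (x k)) powr p) powr (1 / p))"

text \<open>
  Boundedness of the set in the second conjunct follows from the first one by the closed graph
  theorem; it is listed because \<^const>\<open>weak_norm\<close> is a supremum in the reals.
\<close>

definition weakly_summable ::
    "real \<Rightarrow> ('k::real_or_complex_field \<Rightarrow> 'x::banach \<Rightarrow> 'x) \<Rightarrow> (nat \<Rightarrow> 'x) set" where
  "weakly_summable p sX =
     {x. (\<forall>f\<in>dual_space sX. summable (\<lambda>k. norm (f (x k)) powr p)) \<and>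
         bdd_above ((\<lambda>f. (\<Sum>k. norm (f (x k)) powr p) powr (1 / p)) ` dual_ball sX)}"

definition unconditionally_summable ::
    "real \<Rightarrow> ('k::real_or_complex_field \<Rightarrow> 'x::banach \<Rightarrow> 'x) \<Rightarrow> (nat \<Rightarrow> 'x) set" where
  "unconditionally_summable p sX =
     {x \<in> weakly_summable p sX.
        (\<lambda>n. weak_norm p sX (\<lambda>k. if k < n then 0 else x k)) \<longlonglongrightarrow> 0}"

definition dual_exponent :: "real \<Rightarrow> real" where
  "dual_exponent p = p / (p - 1)"

definition ell_ball :: "real \<Rightarrow> (nat \<Rightarrow> 'k::real_normed_field) set" where
  "ell_ball q = {c. summable (\<lambda>k. norm (c k) powr q) \<and>
                    (\<Sum>k. norm (c k) powr q) powr (1 / q) \<le> 1}"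

definition c0_ball :: "(nat \<Rightarrow> 'k::real_normed_field) set" where
  "c0_ball = {c. c \<longlonglongrightarrow> 0 \<and> (\<forall>k. norm (c k) \<le> 1)}"

definition p_convex_hull ::
    "real \<Rightarrow> ('k::real_or_complex_field \<Rightarrow> 'x::banach \<Rightarrow> 'x) \<Rightarrow> (nat \<Rightarrow> 'x) \<Rightarrow> 'x set" where
  "p_convex_hull p sX x =
     {z. \<exists>c \<in> (if p = 1 then c0_ball else ell_ball (dual_exponent p)).
           (\<lambda>k. sX (c k) (x k)) sums z}"

definition Kup_witnesses ::
    "real \<Rightarrow> ('k::real_or_complex_field \<Rightarrow> 'x::banach \<Rightarrow> 'x) \<Rightarrow> ('k \<Rightarrow> 'y::banach \<Rightarrow> 'y)
      \<Rightarrow> ('x \<Rightarrow> 'y) \<Rightarrow> (nat \<Rightarrow> 'y) set" where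
  "Kup_witnesses p sX sY T =
     {y \<in> unconditionally_summable p sY. T ` cball 0 1 \<subseteq> p_convex_hull p sY y}"

definition Kup ::
    "real \<Rightarrow> ('k::real_or_complex_field \<Rightarrow> 'x::banach \<Rightarrow> 'x) \<Rightarrow> ('k \<Rightarrow> 'y::banach \<Rightarrow> 'y)
      \<Rightarrow> ('x \<Rightarrow> 'y) set" where
  "Kup p sX sY = {T \<in> bounded_operators sX sY. Kup_witnesses p sX sY T \<noteq> {}}"

definition Kup_norm ::
    "real \<Rightarrow> ('k::real_or_complex_field \<Rightarrow> 'x::banach \<Rightarrow> 'x) \<Rightarrow> ('k \<Rightarrow> 'y::banach \<Rightarrow> 'y)
      \<Rightarrow> ('x \<Rightarrow> 'y) \<Rightarrow> real" where
  "Kup_norm p sX sY T = (INF y\<in>Kup_witnesses p sX sY T. weak_norm p sY y)"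

text \<open>
  A definition cannot quantify over types, so the type \<open>'y\<close> carrying the Banach spaces \<open>Y\<close> is a
  parameter: the approximation property of \<open>X\<close> is the predicate below for all \<open>'y\<close>.
  The membership of \<open>T - S\<close> in \<^const>\<open>Kup\<close> is automatic by the ideal property;
  it is listed because \<^const>\<open>Kup_norm\<close> is meaningless outside \<^const>\<open>Kup\<close>.
\<close>

definition has_Kup_AP ::
    "'y::banach itself \<Rightarrow> real \<Rightarrow> ('k::real_or_complex_field \<Rightarrow> 'x::banach \<Rightarrow> 'x) \<Rightarrow> bool" where
  "has_Kup_AP _ p sX \<longleftrightarrow>
     (\<forall>sY :: 'k \<Rightarrow> 'y \<Rightarrow> 'y. banach_over sY \<longrightarrow>
        (\<forall>T \<in> Kup p sY sX. \<forall>e>0. \<exists>S \<in> finite_rank_operators sY sX.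
           (\<lambda>y. T y - S y) \<in> Kup p sY sX \<and> Kup_norm p sY sX (\<lambda>y. T y - S y) < e))"

text \<open>
  The \<open>L\<^sup>2\<close> norm of \<open>\<Sum>k<n. r\<^sub>k x\<^sub>k\<close> for independent Rademacher variables \<open>r\<^sub>k\<close>,
  written as the average over all \<open>2 ^ n\<close> choices of signs.
\<close>

definition rademacher_norm :: "nat \<Rightarrow> (nat \<Rightarrow> 'x::real_normed_vector) \<Rightarrow> real" where
  "rademacher_norm n x =
     sqrt ((\<Sum>\<epsilon> \<in> {..<n} \<rightarrow>\<^sub>E {- 1, 1}. (norm (\<Sum>k<n. \<epsilon> k *\<^sub>R x k))\<^sup>2) / 2 ^ n)"

definition has_cotype :: "'x::real_normed_vector itself \<Rightarrow> real \<Rightarrow> bool" where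
  "has_cotype _ q \<longleftrightarrow>
     (\<exists>C. \<forall>n. \<forall>x :: nat \<Rightarrow> 'x.
        (\<Sum>k<n. norm (x k) powr q) powr (1 / q) \<le> C * rademacher_norm n x)"

end

theory Submission
  imports Defs "HOL-Computational_Algebra.Polynomial"
begin

text \<open>
  Let \<open>T\<close> map the unit ball of \<open>Y\<close> into the \<open>p\<close>-convex hull of \<open>(x\<^sub>k)\<close>. It suffices to find a finite-rank
  operator \<open>A\<close> on \<open>X\<close> for which \<open>(x\<^sub>k - A x\<^sub>k)\<close> has small weak \<open>p\<close>-norm, because this sequence dominates
  \<open>T - A T\<close>. Two facts provide \<open>A\<close>.

  Cotype 2 makes weakly \<open>p\<close>-summable sequences factor through a Hilbert space. The sequence \<open>(x\<^sub>k)\<close>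
  defines an operator \<open>c \<mapsto> \<Sum> c\<^sub>k x\<^sub>k\<close> on \<open>\<ell>\<^sup>p\<^sup>'\<close> (on \<open>c\<^sub>0\<close> if \<open>p = 1\<close>). For \<open>p = 1\<close> it is 2-summing by a theorem
  of Maurey (\<open>cotype_2_two_summing\<close>); for larger \<open>p\<close> it is 2-convex, because multiplying
  \<open>(x\<^sub>k)\<close> by a sequence in \<open>\<ell>\<^sup>p\<^sup>'\<close> leads back to \<open>p = 1\<close> (\<open>cotype_2_square_function_estimate\<close>). The
  Hahn-Banach theorem then gives weights \<open>w\<close> with \<open>\<parallel>\<Sum> c\<^sub>k x\<^sub>k\<parallel>\<^sup>2 \<le> L \<Sum> c\<^sub>k\<^sup>2 w\<^sub>k\<close> and \<open>\<Sum> w\<^sub>k\<^sup>s \<le> 1\<close>, where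
  \<open>s = p / (2 - p)\<close> (\<open>Maurey_weights\<close>). So \<open>x\<^sub>k = \<surd>w\<^sub>k z\<^sub>k\<close> with a Bessel sequence \<open>(z\<^sub>k)\<close>, the image
  of the unit vectors under a bounded operator \<open>Q\<close> from \<open>\<ell>\<^sup>2\<close> to \<open>X\<close>. The hypothesis \<open>p < 2\<close> enters
  here: it makes \<open>s\<close> finite, so that \<open>\<Sum> w\<^sub>k\<^sup>s\<close> has small tails.

  In the Hilbert space approximation is free. Every orthogonal projection \<open>P\<close> onto a
  finite-dimensional subspace of the range of the adjoint of \<open>Q\<close> satisfies \<open>Q P = A Q\<close> for a
  finite-rank operator \<open>A\<close> on \<open>X\<close>. Since \<open>P\<close> is a contraction, these operators are uniformly bounded
  along \<open>(z\<^sub>k)\<close>, and \<open>z\<^sub>k - A z\<^sub>k\<close> can be made small for finitely many \<open>k\<close>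
  (\<open>Bessel_sequence_finite_rank_approximation\<close>). The remaining \<open>k\<close> are handled by the tails of
  \<open>\<Sum> w\<^sub>k\<^sup>s\<close> (\<open>weighted_finite_rank_approximation\<close>).

  All this is done over the reals, where a norm bound is tested by real functionals; the scalar
  field is restored at the end (\<open>weakly_summable_finite_rank_approximation\<close>).
\<close>

section \<open>The Hahn-Banach theorem for sublinear functionals\<close>

definition sublinear :: "(real \<Rightarrow> 'v::ab_group_add \<Rightarrow> 'v) \<Rightarrow> ('v \<Rightarrow> real) \<Rightarrow> bool" where
  "sublinear scl q \<longleftrightarrow>
     (\<forall>x y. q (x + y) \<le> q x + q y) \<and> (\<forall>t x. 0 \<le> t \<longrightarrow> q (scl t x) = t * q x)"

lemma sublinear_zero:
  assumes "vector_space scl" "sublinear scl q"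
  shows "q 0 = 0"
proof -
  interpret vector_space scl by fact
  have "q (scl 0 0) = 0 * q 0" using assms(2) unfolding sublinear_def by blast
  then show ?thesis by simp
qed

lemma sublinear_minus:
  assumes "vector_space scl" "sublinear scl q"
  shows "- q (- x) \<le> q x"
proof -
  have "q (x + - x) \<le> q x + q (- x)" using assms(2) unfolding sublinear_def by blast
  then show ?thesis using sublinear_zero[OF assms] by simp
qed

text \<open>
  The infimal convolution of a sublinear functional with a cone of constraints \<open>r \<le> q v\<close>. It turns
  each constraint into the upper bound \<open>- r\<close> at \<open>- v\<close>, which any linear minorant then reads as
  \<open>r \<le> W v\<close>. The same step produces linearity of minimal functionals (cone spanned by one vector),
  norming functionals, and the density in Maurey's factorization.
\<close>

lemma sublinear_minorant:
  fixes scl :: "real \<Rightarrow> 'v::ab_group_add \<Rightarrow> 'v"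
  assumes V: "vector_space scl" and q: "sublinear scl q"
    and zero: "(0, 0) \<in> P"
    and add: "\<And>v r v' r'. (v, r) \<in> P \<Longrightarrow> (v', r') \<in> P \<Longrightarrow> (v + v', r + r') \<in> P"
    and cone: "\<And>v r t. (v, r) \<in> P \<Longrightarrow> 0 < t \<Longrightarrow> (scl t v, t * r) \<in> P"
    and le: "\<And>v r. (v, r) \<in> P \<Longrightarrow> r \<le> q v"
  obtains q' where "sublinear scl q'" "\<And>x. q' x \<le> q x" "\<And>v r. (v, r) \<in> P \<Longrightarrow> q' (- v) \<le> - r"
proof -
  interpret vector_space scl by fact
  have sub: "q (x + y) \<le> q x + q y" and hom: "0 \<le> t \<Longrightarrow> q (scl t x) = t * q x" for x y t
    using q unfolding sublinear_def by blast+
  define q' where "q' x = (INF vr\<in>P. q (x + fst vr) - snd vr)" for x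
  have low: "- q (- x) \<le> q (x + v) - r" if "(v, r) \<in> P" for x v r
  proof -
    have "q v \<le> q (x + v) + q (- x)" using sub[of "x + v" "- x"] by simp
    then show ?thesis using le[OF that] by simp
  qed
  have bdd: "bdd_below ((\<lambda>vr. q (x + fst vr) - snd vr) ` P)" for x
    by (rule bdd_belowI[of _ "- q (- x)"]) (use low in auto)
  have upper: "q' x \<le> q (x + v) - r" if "(v, r) \<in> P" for x v r
    unfolding q'_def using cINF_lower[OF bdd that] by simp
  have greatest: "m \<le> q' x" if "\<And>v r. (v, r) \<in> P \<Longrightarrow> m \<le> q (x + v) - r" for m x
    unfolding q'_def by (rule cINF_greatest) (use zero that in auto)
  have add': "q' (x + y) \<le> q' x + q' y" for x y
  proof -
    have "q' (x + y) - q' x \<le> q' y"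
    proof (rule greatest)
      fix v r assume vr: "(v, r) \<in> P"
      have "q' (x + y) - (q (y + v) - r) \<le> q' x"
      proof (rule greatest)
        fix v' r' assume v'r': "(v', r') \<in> P"
        have "q' (x + y) \<le> q ((x + y) + (v + v')) - (r + r')" by (rule upper[OF add[OF vr v'r']])
        also have "q ((x + y) + (v + v')) \<le> q (y + v) + q (x + v')"
          using sub[of "y + v" "x + v'"] by (simp add: algebra_simps)
        finally show "q' (x + y) - (q (y + v) - r) \<le> q (x + v') - r'" by simp
      qed
      then show "q' (x + y) - q' x \<le> q (y + v) - r" by simp
    qed
    then show ?thesis by simp
  qed
  have half: "q' (scl t x) \<le> t * q' x" if t: "0 < t" for t x
  proof -
    have "q' (scl t x) / t \<le> q' x"
    proof (rule greatest)
      fix v r assume "(v, r) \<in> P"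
      from upper[OF cone[OF this t], of "scl t x"]
      have "q' (scl t x) \<le> q (scl t (x + v)) - t * r" by (simp add: scale_right_distrib)
      then show "q' (scl t x) / t \<le> q (x + v) - r"
        using t hom[of t "x + v"] by (simp add: field_simps)
    qed
    then show ?thesis using t by (simp add: field_simps)
  qed
  have hom': "q' (scl t x) = t * q' x" if "0 \<le> t" for t x
  proof (cases "t = 0")
    case True
    have "q' 0 \<le> 0" using upper[OF zero, of 0] sublinear_zero[OF V q] by simp
    moreover have "0 \<le> q' 0" using greatest[of 0 0] low[of _ _ 0] sublinear_zero[OF V q] by force
    ultimately show ?thesis using True by simp
  next
    case False
    then have t: "0 < t" using that by simp
    have "q' (scl (1 / t) (scl t x)) \<le> (1 / t) * q' (scl t x)" by (rule half) (use t in simp)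
    then have "t * q' x \<le> q' (scl t x)" using t by (simp add: field_simps)
    then show ?thesis using half[OF t, of x] by simp
  qed
  show ?thesis
  proof (rule that)
    show "sublinear scl q'" unfolding sublinear_def using add' hom' by blast
    show "q' x \<le> q x" for x using upper[OF zero, of x] by simp
    show "q' (- v) \<le> - r" if "(v, r) \<in> P" for v r
      using upper[OF that, of "- v"] sublinear_zero[OF V q] by simp
  qed
qed

text \<open>
  Zorn's lemma: the pointwise infimum of a chain stays sublinear because two members of the chain
  can be replaced by the smaller one, and it is finite because \<open>- q (- x)\<close> is a lower bound.
\<close>

lemma sublinear_minimal:
  fixes scl :: "real \<Rightarrow> 'v::ab_group_add \<Rightarrow> 'v"
  assumes V: "vector_space scl" and q: "sublinear scl q"
  obtains m where "sublinear scl m" "m \<le> q" "\<And>q'. sublinear scl q' \<Longrightarrow> q' \<le> m \<Longrightarrow> q' = m"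
proof -
  define S where "S = {q'. sublinear scl q' \<and> q' \<le> q}"
  define ge where "ge = (\<lambda>f g :: 'v \<Rightarrow> real. g \<le> f)"
  have "\<exists>m\<in>S. \<forall>a\<in>S. ge m a \<longrightarrow> a = m"
  proof (rule predicate_Zorn)
    show "partial_order_on S (relation_of ge S)"
      by (rule partial_order_on_relation_ofI) (auto simp: ge_def)
    fix C assume C: "C \<in> Chains (relation_of ge S)"
    then have CS: "C \<subseteq> S" by (auto simp: Chains_def relation_of_def)
    have comp: "f \<le> g \<or> g \<le> f" if "f \<in> C" "g \<in> C" for f g
      using C that by (auto simp: Chains_def relation_of_def ge_def)
    show "\<exists>u\<in>S. \<forall>a\<in>C. ge a u"
    proof (cases "C = {}")
      case True then show ?thesis using q by (auto simp: S_def)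
    next
      case ne: False
      define u where "u x = (INF f\<in>C. f x)" for x
      have sf: "sublinear scl f" and fq: "f x \<le> q x" if "f \<in> C" for f x
        using CS that by (auto simp: S_def le_fun_def)
      have bdd: "bdd_below ((\<lambda>f. f x) ` C)" for x
      proof (rule bdd_belowI2)
        fix f assume f: "f \<in> C"
        show "- q (- x) \<le> f x" using sublinear_minus[OF V sf[OF f], of x] fq[OF f, of "- x"] by simp
      qed
      have up: "u x \<le> f x" if "f \<in> C" for f x unfolding u_def by (rule cINF_lower[OF bdd that])
      have gr: "a \<le> u x" if "\<And>f. f \<in> C \<Longrightarrow> a \<le> f x" for a x
        unfolding u_def by (rule cINF_greatest[OF ne that])
      have "u (x + y) \<le> u x + u y" for x y
      proof -
        have "u (x + y) - u y \<le> u x"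
        proof (rule gr)
          fix f assume f: "f \<in> C"
          have "u (x + y) - f x \<le> u y"
          proof (rule gr)
            fix g assume g: "g \<in> C"
            obtain h where h: "h \<in> C" "h \<le> f" "h \<le> g" using comp[OF f g] f g by blast
            have "u (x + y) \<le> h (x + y)" by (rule up[OF h(1)])
            also have "\<dots> \<le> h x + h y" using sf[OF h(1)] by (auto simp: sublinear_def)
            also have "\<dots> \<le> f x + g y" using h by (intro add_mono) (auto simp: le_fun_def)
            finally show "u (x + y) - f x \<le> g y" by simp
          qed
          then show "u (x + y) - u y \<le> f x" by simp
        qed
        then show ?thesis by simp
      qed
      moreover have "u (scl t x) = t * u x" if t: "0 \<le> t" for t x
      proof -
        have eq: "f (scl t x) = t * f x" if "f \<in> C" for f
          using sf[OF that] t by (auto simp: sublinear_def)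
        have 1: "t * u x \<le> u (scl t x)"
          by (rule gr) (simp add: eq mult_left_mono[OF up t])
        have 2: "u (scl t x) \<le> t * u x"
        proof (cases "t = 0")
          case True
          obtain f where "f \<in> C" using ne by blast
          then show ?thesis using up[of f "scl t x"] eq[of f] True by simp
        next
          case False
          have "u (scl t x) / t \<le> u x"
            by (rule gr) (use eq up[of _ "scl t x"] t False in \<open>simp add: field_simps\<close>)
          then show ?thesis using t False by (simp add: field_simps)
        qed
        from 1 2 show ?thesis by simp
      qed
      moreover have "u \<le> q"
      proof -
        obtain f where "f \<in> C" using ne by blast
        then have "u x \<le> q x" for x using up[of f x] fq[of f x] by simp
        then show ?thesis by (simp add: le_fun_def)
      qed
      ultimately have "u \<in> S" by (auto simp: S_def sublinear_def)
      then show ?thesis using up by (auto simp: ge_def le_fun_def)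
    qed
  qed
  then obtain m where m: "m \<in> S" "\<And>a. a \<in> S \<Longrightarrow> a \<le> m \<Longrightarrow> a = m" by (auto simp: ge_def)
  show ?thesis
  proof (rule that)
    show "sublinear scl m" "m \<le> q" using m(1) by (auto simp: S_def)
    show "q' = m" if "sublinear scl q'" "q' \<le> m" for q'
      using m(1) m(2)[of q'] that by (auto simp: S_def)
  qed
qed

text \<open>
  A minimal sublinear functional \<open>W\<close> is linear: lowering it along the ray through \<open>y\<close> cannot change
  it, which forces \<open>W (- y) \<le> - W y\<close>. The scalar multiplication is a parameter because the theorem
  is used both for normed spaces and for finitely supported sequences.
\<close>

theorem Hahn_Banach_sandwich:
  fixes scl :: "real \<Rightarrow> 'v::ab_group_add \<Rightarrow> 'v"
  assumes V: "vector_space scl" and q: "sublinear scl q"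
    and zero: "(0, 0) \<in> P"
    and add: "\<And>v r v' r'. (v, r) \<in> P \<Longrightarrow> (v', r') \<in> P \<Longrightarrow> (v + v', r + r') \<in> P"
    and cone: "\<And>v r t. (v, r) \<in> P \<Longrightarrow> 0 < t \<Longrightarrow> (scl t v, t * r) \<in> P"
    and le: "\<And>v r. (v, r) \<in> P \<Longrightarrow> r \<le> q v"
  obtains W where "Vector_Spaces.linear scl (*) W" "\<And>x. W x \<le> q x" "\<And>v r. (v, r) \<in> P \<Longrightarrow> r \<le> W v"
proof -
  interpret vector_space scl by fact
  obtain q' where q': "sublinear scl q'" "\<And>x. q' x \<le> q x" "\<And>v r. (v, r) \<in> P \<Longrightarrow> q' (- v) \<le> - r"
    using sublinear_minorant[OF V q zero add cone le] by blast
  obtain W where W: "sublinear scl W" "W \<le> q'" "\<And>q''. sublinear scl q'' \<Longrightarrow> q'' \<le> W \<Longrightarrow> q'' = W"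
    using sublinear_minimal[OF V q'(1)] by blast
  have hom: "W (scl t x) = t * W x" if "0 \<le> t" for t x
    using W(1) that unfolding sublinear_def by blast
  have W0: "W 0 = 0" by (rule sublinear_zero[OF V W(1)])
  have super: "W x + W y \<le> W (x + y)" for x y
  proof -
    define R where "R = {(scl t y, t * W y) | t. 0 \<le> t}"
    obtain q'' where q'': "sublinear scl q''" "\<And>x. q'' x \<le> W x"
        "\<And>v r. (v, r) \<in> R \<Longrightarrow> q'' (- v) \<le> - r"
    proof (rule sublinear_minorant[OF V W(1), of R])
      show "(0, 0) \<in> R" unfolding R_def by (auto intro!: exI[of _ 0])
      show "(v + v', r + r') \<in> R" if m1: "(v, r) \<in> R" and m2: "(v', r') \<in> R" for v r v' r'
      proof -
        obtain t where "0 \<le> t" "v = scl t y" "r = t * W y"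
          using m1 by (auto simp: R_def)
        moreover obtain t' where "0 \<le> t'" "v' = scl t' y" "r' = t' * W y"
          using m2 by (auto simp: R_def)
        ultimately show ?thesis unfolding R_def
          by (auto intro!: exI[of _ "t + t'"] simp: scale_left_distrib distrib_right)
      qed
      show "(scl t v, t * r) \<in> R" if vr: "(v, r) \<in> R" and t: "0 < t" for v r t
      proof -
        obtain t' where "0 \<le> t'" "v = scl t' y" "r = t' * W y" using vr by (auto simp: R_def)
        then show ?thesis unfolding R_def using t by (auto intro!: exI[of _ "t * t'"])
      qed
      show "r \<le> W v" if "(v, r) \<in> R" for v r using that hom by (auto simp: R_def)
    qed blast
    have eq: "q'' = W" by (rule W(3)) (use q'' in \<open>auto simp: le_fun_def\<close>)
    have "(y, W y) \<in> R" unfolding R_def by (auto intro!: exI[of _ 1])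
    from q''(3)[OF this] have neg: "W (- y) \<le> - W y" by (simp add: eq)
    have "W (x + y + - y) \<le> W (x + y) + W (- y)"
      using W(1) unfolding sublinear_def by blast
    then have "W x \<le> W (x + y) + W (- y)" by simp
    then show ?thesis using neg by simp
  qed
  have add': "W (x + y) = W x + W y" for x y
    using super[of x y] W(1) unfolding sublinear_def by (meson order_antisym)
  have neg: "W (- x) = - W x" for x using add'[of x "- x"] W0 by simp
  have hom': "W (scl t x) = t * W x" for t x
  proof (cases "0 \<le> t")
    case False
    have "W (scl t x) = - W (scl (- t) x)" using neg[of "scl t x"] by simp
    then show ?thesis using hom[of "- t" x] False by simp
  qed (rule hom)
  show ?thesis
  proof (rule that)
    show "Vector_Spaces.linear scl (*) W"
      by (intro Vector_Spaces.linear_iff[THEN iffD2] conjI V) (use add' hom' in \<open>auto simp: vector_space_def algebra_simps\<close>)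
    show "W x \<le> q x" for x using W(2) q'(2)[of x] by (auto simp: le_fun_def intro: order_trans)
    show "r \<le> W v" if "(v, r) \<in> P" for v r
    proof -
      have "W (- v) \<le> - r" using W(2) q'(3)[OF that] by (auto simp: le_fun_def intro: order_trans)
      then show ?thesis using neg by simp
    qed
  qed
qed

lemma norming_functional:
  fixes x :: "'x::real_normed_vector"
  obtains \<phi> :: "'x \<Rightarrow> real" where "bounded_linear \<phi>" "\<And>y. \<bar>\<phi> y\<bar> \<le> norm y" "\<phi> x = norm x"
proof -
  have V: "vector_space (scaleR :: real \<Rightarrow> 'x \<Rightarrow> 'x)" by (rule real_vector.vector_space_axioms)
  obtain W where W: "Vector_Spaces.linear scaleR (*) W" "\<And>y. W y \<le> norm y"
      "\<And>v r. (v, r) \<in> {(t *\<^sub>R x, t * norm x) | t. 0 \<le> t} \<Longrightarrow> r \<le> W v"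
  proof (rule Hahn_Banach_sandwich[OF V, of norm "{(t *\<^sub>R x, t * norm x) | t. 0 \<le> t}"])
    show "sublinear scaleR (norm :: 'x \<Rightarrow> real)" by (auto simp: sublinear_def norm_triangle_ineq)
    show "(0, 0) \<in> {(t *\<^sub>R x, t * norm x) | t. 0 \<le> t}" by (auto intro!: exI[of _ 0])
    show "(v + v', r + r') \<in> {(t *\<^sub>R x, t * norm x) | t. 0 \<le> t}"
      if m1: "(v, r) \<in> {(t *\<^sub>R x, t * norm x) | t. 0 \<le> t}" and m2: "(v', r') \<in> {(t *\<^sub>R x, t * norm x) | t. 0 \<le> t}" for v r v' r'
    proof -
      obtain t where "0 \<le> t" "v = t *\<^sub>R x" "r = t * norm x"
        using m1 by auto
      moreover obtain t' where "0 \<le> t'" "v' = t' *\<^sub>R x" "r' = t' * norm x"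
        using m2 by auto
      ultimately show ?thesis by (auto intro!: exI[of _ "t + t'"] simp: algebra_simps)
    qed
    show "(t *\<^sub>R v, t * r) \<in> {(t *\<^sub>R x, t * norm x) | t. 0 \<le> t}"
      if m1: "(v, r) \<in> {(t *\<^sub>R x, t * norm x) | t. 0 \<le> t}" and t: "0 < t" for v r t
    proof -
      obtain t' where "0 \<le> t'" "v = t' *\<^sub>R x" "r = t' * norm x" using m1 by auto
      then show ?thesis using t by (auto intro!: exI[of _ "t * t'"])
    qed
  qed auto
  have lin: "linear W" using W(1) by (simp add: linear_def real_scaleR_def[abs_def])
  have abs: "\<bar>W y\<bar> \<le> norm y" for y
    using W(2)[of y] W(2)[of "- y"] linear_neg[OF lin, of y] by simp
  show ?thesis
  proof (rule that)
    show "bounded_linear W" 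
      by (intro bounded_linear_intro[of _ 1]) (use lin abs in \<open>auto simp: linear_add linear_scale\<close>)
    show "W x = norm x" using W(2)[of x] W(3)[of x "norm x"] by (force intro!: exI[of _ 1])
  qed (rule abs)
qed

section \<open>Operators from bounded sequences into spaces of cotype 2\<close>

abbreviation signs :: "nat \<Rightarrow> (nat \<Rightarrow> real) set" where
  "signs m \<equiv> {..<m} \<rightarrow>\<^sub>E {- 1, 1}"

lemma sum_signs_Suc:
  "(\<Sum>\<epsilon>\<in>signs (Suc m). F \<epsilon>) = (\<Sum>\<epsilon>\<in>signs m. F (\<epsilon>(m := 1)) + F (\<epsilon>(m := - 1)) :: real)"
proof -
  have "signs (Suc m) = (\<lambda>(y, g). g(m := y)) ` ({- 1, 1} \<times> signs m)"
    by (simp add: lessThan_Suc PiE_insert_eq)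
  moreover have "inj_on (\<lambda>(y, g). g(m := y)) ({- 1, 1 :: real} \<times> signs m)"
    by (rule inj_combinator) simp
  ultimately have "(\<Sum>\<epsilon>\<in>signs (Suc m). F \<epsilon>) = (\<Sum>(y, g)\<in>{- 1, 1} \<times> signs m. F (g(m := y)))"
    by (simp add: sum.reindex case_prod_unfold)
  also have "\<dots> = (\<Sum>y\<in>{- 1, 1}. \<Sum>g\<in>signs m. F (g(m := y)))"
    by (rule sum.cartesian_product[symmetric])
  finally show ?thesis by (simp add: sum.distrib)
qed

lemma finite_signs: "finite (signs m)"
  by (rule finite_PiE) auto

lemma card_signs: "real (card (signs m)) = 2 ^ m"
  by (subst card_PiE) (auto simp: card_insert_if)

lemma sign_sum_upd:
  "(\<Sum>i<Suc m. (\<epsilon>(m := b)) i * a i) = (\<Sum>i<m. \<epsilon> i * a i) + b * (a m :: real)"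
proof -
  have "(\<Sum>i<m. (\<epsilon>(m := b)) i * a i) = (\<Sum>i<m. \<epsilon> i * a i)"
    by (rule sum.cong) auto
  then show ?thesis by simp
qed

lemma Rademacher_second_moment:
  "(\<Sum>\<epsilon>\<in>signs m. (\<Sum>i<m. \<epsilon> i * a i)\<^sup>2) = 2 ^ m * (\<Sum>i<m. (a i)\<^sup>2)"
proof (induction m)
  case (Suc m)
  have "(\<Sum>\<epsilon>\<in>signs (Suc m). (\<Sum>i<Suc m. \<epsilon> i * a i)\<^sup>2)
      = (\<Sum>\<epsilon>\<in>signs m. 2 * (\<Sum>i<m. \<epsilon> i * a i)\<^sup>2 + 2 * (a m)\<^sup>2)"
    unfolding sum_signs_Suc sign_sum_upd
    by (intro sum.cong refl) (simp add: power2_eq_square algebra_simps)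
  also have "\<dots> = 2 ^ Suc m * (\<Sum>i<Suc m. (a i)\<^sup>2)"
    by (simp add: sum.distrib sum_distrib_left[symmetric] Suc.IH card_signs algebra_simps)
  finally show ?case .
qed (simp add: PiE_empty_domain)

lemma Rademacher_fourth_moment:
  "(\<Sum>\<epsilon>\<in>signs m. (\<Sum>i<m. \<epsilon> i * a i) ^ 4) \<le> 3 * 2 ^ m * (\<Sum>i<m. (a i)\<^sup>2)\<^sup>2"
proof (induction m)
  case (Suc m)
  define A where "A = (\<Sum>i<m. (a i)\<^sup>2)"
  have A: "0 \<le> A" unfolding A_def by (simp add: sum_nonneg)
  have "(\<Sum>\<epsilon>\<in>signs (Suc m). (\<Sum>i<Suc m. \<epsilon> i * a i) ^ 4)
      = (\<Sum>\<epsilon>\<in>signs m. 2 * (\<Sum>i<m. \<epsilon> i * a i) ^ 4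
            + 12 * (a m)\<^sup>2 * (\<Sum>i<m. \<epsilon> i * a i)\<^sup>2 + 2 * (a m) ^ 4)"
    unfolding sum_signs_Suc sign_sum_upd
    by (intro sum.cong refl) (simp add: power2_eq_square power4_eq_xxxx algebra_simps)
  also have "\<dots> = 2 * (\<Sum>\<epsilon>\<in>signs m. (\<Sum>i<m. \<epsilon> i * a i) ^ 4)
            + 12 * (a m)\<^sup>2 * (2 ^ m * A) + 2 ^ m * (2 * (a m) ^ 4)"
    by (simp add: sum.distrib sum_distrib_left[symmetric] Rademacher_second_moment card_signs A_def)
  also have "\<dots> \<le> 2 * (3 * 2 ^ m * A\<^sup>2) + 12 * (a m)\<^sup>2 * (2 ^ m * A) + 2 ^ m * (6 * (a m) ^ 4)"
    using Suc.IH unfolding A_def by (intro add_mono mult_left_mono) auto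
  also have "\<dots> = 3 * 2 ^ Suc m * (\<Sum>i<Suc m. (a i)\<^sup>2)\<^sup>2"
  proof -
    have "(\<Sum>i<Suc m. (a i)\<^sup>2) = A + (a m)\<^sup>2" by (simp add: A_def)
    then show ?thesis by (simp add: power2_eq_square power4_eq_xxxx algebra_simps)
  qed
  finally show ?case .
qed (simp add: PiE_empty_domain)

lemma has_cotype_2E:
  assumes "has_cotype TYPE('x::real_normed_vector) 2"
  obtains \<kappa> where "0 < \<kappa>"
    "\<And>m (x :: nat \<Rightarrow> 'x).
       (\<Sum>i<m. (norm (x i))\<^sup>2) \<le> \<kappa> * ((\<Sum>\<epsilon>\<in>signs m. (norm (\<Sum>i<m. \<epsilon> i *\<^sub>R x i))\<^sup>2) / 2 ^ m)"
proof -
  obtain C where C: "\<And>n (x :: nat \<Rightarrow> 'x).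
      (\<Sum>k<n. norm (x k) powr 2) powr (1 / 2) \<le> C * rademacher_norm n x"
    using assms unfolding has_cotype_def by blast
  define C' where "C' = max C 1"
  have "(\<Sum>i<m. (norm (x i))\<^sup>2) \<le> C'\<^sup>2 * ((\<Sum>\<epsilon>\<in>signs m. (norm (\<Sum>i<m. \<epsilon> i *\<^sub>R x i))\<^sup>2) / 2 ^ m)"
    for m and x :: "nat \<Rightarrow> 'x"
  proof -
    have pos: "0 \<le> (\<Sum>\<epsilon>\<in>signs m. (norm (\<Sum>i<m. \<epsilon> i *\<^sub>R x i))\<^sup>2) / 2 ^ m"
      by (simp add: sum_nonneg)
    have "sqrt (\<Sum>i<m. (norm (x i))\<^sup>2) \<le> C * rademacher_norm m x"
      using C[where n=m and x=x] by (simp add: powr_half_sqrt sum_nonneg)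
    also have "\<dots> \<le> C' * rademacher_norm m x"
      unfolding C'_def rademacher_norm_def using pos by (intro mult_right_mono) auto
    finally have "(sqrt (\<Sum>i<m. (norm (x i))\<^sup>2))\<^sup>2 \<le> (C' * rademacher_norm m x)\<^sup>2"
      by (intro power_mono) (simp_all add: sum_nonneg)
    then show ?thesis
      unfolding rademacher_norm_def power_mult_distrib using pos by (simp add: sum_nonneg)
  qed
  moreover have "0 < C'\<^sup>2" by (simp add: C'_def)
  ultimately show ?thesis using that by blast
qed

text \<open>
  Maurey's theorem that an operator from \<open>\<ell>\<^sub>\<infinity>\<close> into a space of cotype 2 is 2-summing, in finite
  dimensions and by a self-improvement of the best constant \<open>K\<close>. By cotype 2 the left-hand side is
  at most \<open>\<kappa>\<close> times the average over all signs of \<open>\<parallel>U F\<^sub>\<epsilon>\<parallel>\<^sup>2\<close>, where \<open>F\<^sub>\<epsilon> = \<Sum> \<epsilon>\<^sub>i c\<^sub>i\<close>. The part of \<open>F\<^sub>\<epsilon>\<close> below the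
  height \<open>\<surd>T\<close> is controlled by the norm \<open>D\<close> of \<open>U\<close>. The part above it is again a family of
  coefficient sequences, now indexed by the signs. By the fourth moments its squares average to
  at most \<open>3 / T\<close>, so it contributes only a small multiple of \<open>K\<close>, which is absorbed.
\<close>

lemma cotype_2_two_summing:
  fixes x :: "nat \<Rightarrow> 'x::real_normed_vector" and c :: "nat \<Rightarrow> nat \<Rightarrow> real" and m :: nat
  assumes \<kappa>: "0 < \<kappa>"
    and cotype: "\<And>m (y :: nat \<Rightarrow> 'x).
       (\<Sum>i<m. (norm (y i))\<^sup>2) \<le> \<kappa> * ((\<Sum>\<epsilon>\<in>signs m. (norm (\<Sum>i<m. \<epsilon> i *\<^sub>R y i))\<^sup>2) / 2 ^ m)"
    and D: "0 \<le> D" "\<And>c. (\<And>k. k < n \<Longrightarrow> \<bar>c k\<bar> \<le> 1) \<Longrightarrow> norm (\<Sum>k<n. c k *\<^sub>R x k) \<le> D"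
    and c: "\<And>k. k < n \<Longrightarrow> (\<Sum>i<m. (c i k)\<^sup>2) \<le> 1"
  shows "(\<Sum>i<m. (norm (\<Sum>k<n. c i k *\<^sub>R x k))\<^sup>2) \<le> 48 * \<kappa>\<^sup>2 * D\<^sup>2"
proof -
  define U where "U c = (\<Sum>k<n. c k *\<^sub>R x k)" for c
  have U_scale: "U (\<lambda>k. t * c k) = t *\<^sub>R U c" for t c
    by (simp add: U_def scaleR_sum_right)
  define S where "S = {\<Sum>i<m. (norm (U (c i)))\<^sup>2 | (m::nat) c. \<forall>k<n. (\<Sum>i<m. (c i k)\<^sup>2) \<le> (1::real)}"
  have x_le: "norm (x k) \<le> D" if "k < n" for k
  proof -
    have "(\<Sum>j<n. (if j = k then 1 else 0) *\<^sub>R x j) = x k"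
      using that by (simp add: if_distrib[of "\<lambda>a. a *\<^sub>R _"] cong: if_cong)
    then show ?thesis using D(2)[of "\<lambda>j. if j = k then 1 else 0"] by simp
  qed
  have U_le: "(norm (U c))\<^sup>2 \<le> n * D\<^sup>2 * (\<Sum>k<n. (c k)\<^sup>2)" for c
  proof -
    have "norm (U c) \<le> (\<Sum>k<n. \<bar>c k\<bar> * D)"
      unfolding U_def by (rule sum_norm_le) (use x_le in \<open>auto intro: mult_left_mono\<close>)
    then have "(norm (U c))\<^sup>2 \<le> (\<Sum>k<n. \<bar>c k\<bar> * D)\<^sup>2" by (intro power_mono) auto
    also have "\<dots> \<le> (\<Sum>k<n. (\<bar>c k\<bar>)\<^sup>2) * (\<Sum>k<n. D\<^sup>2)" by (rule Cauchy_Schwarz_ineq_sum)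
    finally show ?thesis by (simp add: mult_ac)
  qed
  have bdd: "bdd_above S"
  proof (rule bdd_aboveI)
    fix a assume "a \<in> S"
    then obtain m :: nat and c where a: "a = (\<Sum>i<m. (norm (U (c i)))\<^sup>2)"
      and c: "\<forall>k<n. (\<Sum>i<m. (c i k)\<^sup>2) \<le> 1" unfolding S_def by blast
    have "a \<le> (\<Sum>i<m. n * D\<^sup>2 * (\<Sum>k<n. (c i k)\<^sup>2))" unfolding a by (intro sum_mono U_le)
    also have "\<dots> = n * D\<^sup>2 * (\<Sum>k<n. \<Sum>i<m. (c i k)\<^sup>2)"
      by (subst sum.swap) (simp add: sum_distrib_left)
    also have "\<dots> \<le> n * D\<^sup>2 * (\<Sum>k<n. 1)"
      by (intro mult_left_mono sum_mono) (use c in auto)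
    finally show "a \<le> n * D\<^sup>2 * n" by simp
  qed
  \<comment> \<open>The best constant; it is finite by the crude Cauchy-Schwarz bound just shown.\<close>
  define K where "K = Sup S"
  have K: "(\<Sum>i\<in>I. (norm (U (h i)))\<^sup>2) \<le> T * K"
    if "finite I" and T: "0 < T" and h: "\<And>k. k < n \<Longrightarrow> (\<Sum>i\<in>I. (h i k)\<^sup>2) \<le> T"
    for I :: "(nat \<Rightarrow> real) set" and h :: "(nat \<Rightarrow> real) \<Rightarrow> nat \<Rightarrow> real" and T
  proof -
    obtain e where e: "bij_betw e {..<card I} I"
      using ex_bij_betw_nat_finite[OF \<open>finite I\<close>] by (auto simp: atLeast0LessThan)
    define g where "g i = (\<lambda>k. (1 / sqrt T) * h (e i) k)" for i
    have "(\<Sum>i<card I. (g i k)\<^sup>2) \<le> 1" if "k < n" for k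
    proof -
      have "(\<Sum>i<card I. (g i k)\<^sup>2) = (\<Sum>i<card I. (1 / T) * (h (e i) k)\<^sup>2)"
        using T by (intro sum.cong refl) (simp add: g_def power_mult_distrib power_divide)
      also have "\<dots> = (\<Sum>i\<in>I. (1 / T) * (h i k)\<^sup>2)"
        by (rule sum.reindex_bij_betw[OF e, of "\<lambda>i. (1 / T) * (h i k)\<^sup>2"])
      also have "\<dots> \<le> 1" using h[OF that] T by (simp add: sum_divide_distrib[symmetric])
      finally show ?thesis .
    qed
    then have "(\<Sum>i<card I. (norm (U (g i)))\<^sup>2) \<in> S" unfolding S_def by blast
    then have "(\<Sum>i<card I. (norm (U (g i)))\<^sup>2) \<le> K" unfolding K_def by (rule cSup_upper[OF _ bdd])
    moreover have "(\<Sum>i<card I. (norm (U (g i)))\<^sup>2) = (\<Sum>i<card I. (1 / T) * (norm (U (h (e i))))\<^sup>2)"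
      unfolding g_def U_scale using T by (intro sum.cong refl) (simp add: power_mult_distrib power_divide)
    moreover have "\<dots> = (\<Sum>i\<in>I. (1 / T) * (norm (U (h i)))\<^sup>2)"
      by (rule sum.reindex_bij_betw[OF e, of "\<lambda>i. (1 / T) * (norm (U (h i)))\<^sup>2"])
    ultimately show ?thesis using T by (simp add: sum_divide_distrib[symmetric] field_simps)
  qed
  \<comment> \<open>With this height the tall part contributes \<open>\<kappa> * 6 K / T = K / 2\<close>.\<close>
  define T where "T = 12 * \<kappa>"
  have T: "0 < T" using \<kappa> by (simp add: T_def)
  have main: "(\<Sum>i<m. (norm (U (c i)))\<^sup>2) \<le> 24 * \<kappa>\<^sup>2 * D\<^sup>2 + K / 2"
    if c: "\<And>k. k < n \<Longrightarrow> (\<Sum>i<m. (c i k)\<^sup>2) \<le> 1" for m and c :: "nat \<Rightarrow> nat \<Rightarrow> real"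
  proof -
    define F where "F \<epsilon> k = (\<Sum>i<m. \<epsilon> i * c i k)" for \<epsilon> k
    define big where "big \<epsilon> k = (if (F \<epsilon> k)\<^sup>2 > T then F \<epsilon> k else 0)" for \<epsilon> k
    define small where "small \<epsilon> k = (if (F \<epsilon> k)\<^sup>2 > T then 0 else F \<epsilon> k)" for \<epsilon> k
    have UF: "(\<Sum>i<m. \<epsilon> i *\<^sub>R U (c i)) = U (small \<epsilon>) + U (big \<epsilon>)" for \<epsilon>
    proof -
      have "(\<Sum>i<m. \<epsilon> i *\<^sub>R U (c i)) = U (F \<epsilon>)"
        unfolding U_def F_def scaleR_sum_right scaleR_sum_left by (subst sum.swap) simp
      also have "\<dots> = U (small \<epsilon>) + U (big \<epsilon>)"
        unfolding U_def sum.distrib[symmetric] by (intro sum.cong refl) (simp add: small_def big_def)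
      finally show ?thesis .
    qed
    have small: "(norm (U (small \<epsilon>)))\<^sup>2 \<le> T * D\<^sup>2" for \<epsilon>
    proof -
      have le1: "\<bar>(1 / sqrt T) * small \<epsilon> k\<bar> \<le> 1" for k
      proof -
        have "\<bar>small \<epsilon> k\<bar> \<le> sqrt T"
          using T by (auto simp: small_def intro: real_le_rsqrt)
        then show ?thesis using T by (simp add: abs_mult)
      qed
      have "norm (U (\<lambda>k. (1 / sqrt T) * small \<epsilon> k)) \<le> D"
        unfolding U_def by (rule D(2)) (rule le1)
      then have "norm (U (small \<epsilon>)) \<le> sqrt T * D"
        using T unfolding U_scale by (simp add: field_simps)
      then have "(norm (U (small \<epsilon>)))\<^sup>2 \<le> (sqrt T * D)\<^sup>2" by (intro power_mono) auto
      then show ?thesis using T by (simp add: power_mult_distrib)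
    qed
    have big: "(\<Sum>\<epsilon>\<in>signs m. (norm (U (big \<epsilon>)))\<^sup>2) \<le> 3 * 2 ^ m / T * K"
    proof (rule K[OF finite_signs])
      show "0 < 3 * 2 ^ m / T" using T by simp
      fix k assume k: "k < n"
      have "(big \<epsilon> k)\<^sup>2 \<le> (F \<epsilon> k) ^ 4 / T" for \<epsilon>
      proof (cases "(F \<epsilon> k)\<^sup>2 > T")
        case True
        then have "T * (F \<epsilon> k)\<^sup>2 \<le> (F \<epsilon> k)\<^sup>2 * (F \<epsilon> k)\<^sup>2" by (intro mult_right_mono) auto
        then show ?thesis using T True by (simp add: big_def field_simps power4_eq_xxxx power2_eq_square)
      qed (use T in \<open>simp add: big_def\<close>)
      then have "(\<Sum>\<epsilon>\<in>signs m. (big \<epsilon> k)\<^sup>2) \<le> (\<Sum>\<epsilon>\<in>signs m. (F \<epsilon> k) ^ 4 / T)" by (rule sum_mono)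
      also have "\<dots> \<le> 3 * 2 ^ m * (\<Sum>i<m. (c i k)\<^sup>2)\<^sup>2 / T"
        unfolding sum_divide_distrib[symmetric] F_def
        using T by (intro divide_right_mono Rademacher_fourth_moment) simp
      also have "\<dots> \<le> 3 * 2 ^ m * 1 / T"
        using T c[OF k] by (intro divide_right_mono mult_left_mono power_le_one) (auto simp: sum_nonneg)
      finally show "(\<Sum>\<epsilon>\<in>signs m. (big \<epsilon> k)\<^sup>2) \<le> 3 * 2 ^ m / T" by simp
    qed
    have "(norm (\<Sum>i<m. \<epsilon> i *\<^sub>R U (c i)))\<^sup>2 \<le> 2 * (T * D\<^sup>2) + 2 * (norm (U (big \<epsilon>)))\<^sup>2" for \<epsilon>
    proof -
      have "(norm (\<Sum>i<m. \<epsilon> i *\<^sub>R U (c i)))\<^sup>2 \<le> (norm (U (small \<epsilon>)) + norm (U (big \<epsilon>)))\<^sup>2"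
        unfolding UF by (intro power_mono norm_triangle_ineq) simp
      also have "\<dots> \<le> 2 * (norm (U (small \<epsilon>)))\<^sup>2 + 2 * (norm (U (big \<epsilon>)))\<^sup>2"
        using sum_squares_ge_zero[of "norm (U (small \<epsilon>)) - norm (U (big \<epsilon>))" 0]
        by (simp add: power2_eq_square algebra_simps)
      finally show ?thesis using small[of \<epsilon>] by simp
    qed
    then have "(\<Sum>\<epsilon>\<in>signs m. (norm (\<Sum>i<m. \<epsilon> i *\<^sub>R U (c i)))\<^sup>2)
        \<le> (\<Sum>\<epsilon>\<in>signs m. 2 * (T * D\<^sup>2) + 2 * (norm (U (big \<epsilon>)))\<^sup>2)" by (rule sum_mono)
    also have "\<dots> = 2 ^ m * (2 * (T * D\<^sup>2)) + 2 * (\<Sum>\<epsilon>\<in>signs m. (norm (U (big \<epsilon>)))\<^sup>2)"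
      by (simp add: sum.distrib sum_distrib_left card_signs)
    also have "\<dots> \<le> 2 ^ m * (2 * (T * D\<^sup>2)) + 2 * (3 * 2 ^ m / T * K)" using big by simp
    also have "\<dots> = (2 * (T * D\<^sup>2) + 6 * K / T) * 2 ^ m" by (simp add: algebra_simps)
    finally have "(\<Sum>\<epsilon>\<in>signs m. (norm (\<Sum>i<m. \<epsilon> i *\<^sub>R U (c i)))\<^sup>2) / 2 ^ m \<le> 2 * (T * D\<^sup>2) + 6 * K / T"
      by (simp add: divide_le_eq)
    then have "\<kappa> * ((\<Sum>\<epsilon>\<in>signs m. (norm (\<Sum>i<m. \<epsilon> i *\<^sub>R U (c i)))\<^sup>2) / 2 ^ m)
        \<le> \<kappa> * (2 * (T * D\<^sup>2) + 6 * K / T)"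
      using \<kappa> by (intro mult_left_mono) auto
    also have "\<dots> = 24 * \<kappa>\<^sup>2 * D\<^sup>2 + K / 2"
      using \<kappa> by (simp add: T_def power2_eq_square field_simps)
    finally show ?thesis using cotype[where m = m and y = "\<lambda>i. U (c i)"] by simp
  qed
  have "K \<le> 24 * \<kappa>\<^sup>2 * D\<^sup>2 + K / 2"
    unfolding K_def
  proof (rule cSup_least)
    show "S \<noteq> {}" unfolding S_def by (auto intro!: exI[of _ 0])
    fix a assume "a \<in> S"
    then obtain m :: nat and c where "a = (\<Sum>i<m. (norm (U (c i)))\<^sup>2)" "\<forall>k<n. (\<Sum>i<m. (c i k)\<^sup>2) \<le> 1"
      unfolding S_def by blast
    then show "a \<le> 24 * \<kappa>\<^sup>2 * D\<^sup>2 + Sup S / 2" using main[where m=m and c=c] by (simp add: K_def)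
  qed
  then have "24 * \<kappa>\<^sup>2 * D\<^sup>2 + K / 2 \<le> 48 * \<kappa>\<^sup>2 * D\<^sup>2" by linarith
  then show ?thesis using main[where m=m and c=c, OF c] unfolding U_def by linarith
qed

section \<open>Factorization through a weighted sequence space\<close>

definition weight_ball :: "real \<Rightarrow> (nat \<Rightarrow> real) set" where
  "weight_ball s = {w. (\<forall>k. 0 \<le> w k) \<and> (\<forall>n. (\<Sum>k<n. w k powr s) \<le> 1)}"

text \<open>
  Polynomials serve as finitely supported real sequences: \<open>coeff g k\<close> is the \<open>k\<close>-th entry.
\<close>

definition pairing :: "(nat \<Rightarrow> real) \<Rightarrow> real poly \<Rightarrow> real" where
  "pairing w g = (\<Sum>k\<le>degree g. w k * coeff g k)"

text \<open>
  For \<open>s = p / (2 - p)\<close> the conjugate exponent of \<open>s\<close> is \<open>p' / 2\<close>, so at \<open>g \<ge> 0\<close> this is the norm of \<open>g\<close> in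
  \<open>\<ell>\<^sup>p\<^sup>'\<^sup>/\<^sup>2\<close>, that is, the squared norm of \<open>\<surd>g\<close> in the dual space \<open>\<ell>\<^sup>p\<^sup>'\<close> of \<open>\<ell>\<^sup>p\<close>. Written as a supremum over
  weights it needs no separate treatment of \<open>p = 1\<close>.
\<close>

definition support_function :: "real \<Rightarrow> real poly \<Rightarrow> real" where
  "support_function s g = (SUP w\<in>weight_ball s. pairing w g)"

definition coeff_square :: "real poly \<Rightarrow> real poly" where
  "coeff_square c = (\<Sum>k\<le>degree c. monom ((coeff c k)\<^sup>2) k)"

definition combination :: "(nat \<Rightarrow> 'x::real_vector) \<Rightarrow> real poly \<Rightarrow> 'x" where
  "combination u c = (\<Sum>k\<le>degree c. coeff c k *\<^sub>R u k)"

lemma pairing_eq: "degree g < n \<Longrightarrow> pairing w g = (\<Sum>k<n. w k * coeff g k)"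
  unfolding pairing_def by (rule sum.mono_neutral_left) (auto simp: coeff_eq_0)

lemma combination_eq: "degree c < n \<Longrightarrow> combination u c = (\<Sum>k<n. coeff c k *\<^sub>R u k)"
  unfolding combination_def by (rule sum.mono_neutral_left) (auto simp: coeff_eq_0)

lemma pairing_add: "pairing w (g + h) = pairing w g + pairing w h"
proof -
  define n where "n = Suc (max (degree g) (degree h))"
  have "degree (g + h) < n" "degree g < n" "degree h < n"
    using degree_add_le_max[of g h] by (auto simp: n_def)
  then show ?thesis by (simp add: pairing_eq sum.distrib distrib_left)
qed

lemma pairing_smult: "pairing w (smult t g) = t * pairing w g"
proof -
  have "degree (smult t g) < Suc (degree g)" "degree g < Suc (degree g)" by auto
  then show ?thesis unfolding pairing_eq[OF \<open>degree (smult t g) < _\<close>] pairing_eq[OF \<open>degree g < _\<close>]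
    by (simp add: sum_distrib_left mult_ac del: sum.lessThan_Suc)
qed

lemma combination_smult: "combination u (smult t c) = t *\<^sub>R combination u c"
proof -
  have "degree (smult t c) < Suc (degree c)" "degree c < Suc (degree c)" by auto
  then show ?thesis
    unfolding combination_eq[OF \<open>degree (smult t c) < _\<close>] combination_eq[OF \<open>degree c < _\<close>]
    by (simp add: scaleR_sum_right del: sum.lessThan_Suc)
qed

lemma coeff_coeff_square [simp]: "coeff (coeff_square c) k = (coeff c k)\<^sup>2"
proof -
  have "coeff (coeff_square c) k = (\<Sum>j\<le>degree c. if j = k then (coeff c j)\<^sup>2 else 0)"
    by (simp add: coeff_square_def coeff_sum)
  also have "\<dots> = (coeff c k)\<^sup>2" by (simp add: coeff_eq_0)
  finally show ?thesis .
qed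

lemma coeff_square_smult: "coeff_square (smult t c) = smult (t\<^sup>2) (coeff_square c)"
  by (rule poly_eqI) (simp add: power_mult_distrib)

lemma coeff_sum_list: "coeff (\<Sum>c\<leftarrow>cs. f c) k = (\<Sum>c\<leftarrow>cs. coeff (f c) k)"
  by (induction cs) auto

lemma smult_sum_list: "smult t (\<Sum>c\<leftarrow>cs. f c) = (\<Sum>c\<leftarrow>cs. smult t (f c :: real poly))"
  by (induction cs) (auto simp: smult_add_right)

lemma vector_space_smult: "vector_space (smult :: real \<Rightarrow> real poly \<Rightarrow> real poly)"
  by unfold_locales (auto simp: smult_add_right smult_add_left)

lemma weight_ball_zero: "(\<lambda>_. 0) \<in> weight_ball s"
  by (simp add: weight_ball_def)

lemma weight_ball_le_1:
  assumes s: "1 \<le> s" and w: "w \<in> weight_ball s"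
  shows "w k \<le> 1"
proof (rule ccontr)
  assume "\<not> w k \<le> 1"
  then have "1 < w k powr s" using s by (intro gr_one_powr) auto
  also have "\<dots> \<le> (\<Sum>j<Suc k. w j powr s)" by (rule member_le_sum) auto
  also have "\<dots> \<le> 1" using w unfolding weight_ball_def by blast
  finally show False by simp
qed

lemma support_function_bdd:
  assumes "1 \<le> s"
  shows "bdd_above ((\<lambda>w. pairing w g) ` weight_ball s)"
proof (rule bdd_aboveI2)
  fix w assume w: "w \<in> weight_ball s"
  show "pairing w g \<le> (\<Sum>k\<le>degree g. \<bar>coeff g k\<bar>)"
    unfolding pairing_def
  proof (rule sum_mono)
    fix k
    have "0 \<le> w k" using w by (simp add: weight_ball_def)
    have "w k * coeff g k \<le> w k * \<bar>coeff g k\<bar>" using \<open>0 \<le> w k\<close> by (intro mult_left_mono) auto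
    also have "\<dots> \<le> 1 * \<bar>coeff g k\<bar>" by (intro mult_right_mono weight_ball_le_1[OF assms w]) auto
    finally show "w k * coeff g k \<le> \<bar>coeff g k\<bar>" by simp
  qed
qed

lemma pairing_le_support_function:
  "1 \<le> s \<Longrightarrow> w \<in> weight_ball s \<Longrightarrow> pairing w g \<le> support_function s g"
  unfolding support_function_def by (rule cSUP_upper[OF _ support_function_bdd])

lemma support_function_le:
  "(\<And>w. w \<in> weight_ball s \<Longrightarrow> pairing w g \<le> a) \<Longrightarrow> support_function s g \<le> a"
  unfolding support_function_def by (rule cSUP_least) (use weight_ball_zero in blast)

lemma sublinear_support_function:
  assumes s: "1 \<le> s"
  shows "sublinear smult (support_function s)"
  unfolding sublinear_def
proof (intro conjI allI impI)
  show "support_function s (g + h) \<le> support_function s g + support_function s h" for g h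
    by (rule support_function_le) (simp add: pairing_add add_mono pairing_le_support_function[OF s])
  fix t :: real and g assume t: "0 \<le> t"
  have half: "support_function s (smult t g) \<le> t * support_function s g" if "0 \<le> t" for t g
    by (rule support_function_le)
      (simp add: pairing_smult mult_left_mono that pairing_le_support_function[OF s])
  show "support_function s (smult t g) = t * support_function s g"
  proof (cases "t = 0")
    case True
    have "support_function s 0 \<le> 0" using half[of 0 0] by simp
    moreover have "0 \<le> support_function s 0"
      using pairing_le_support_function[OF s weight_ball_zero, of 0] by (simp add: pairing_def)
    ultimately show ?thesis using True by simp
  next
    case False
    then have "t * support_function s g \<le> support_function s (smult t g)"
      using half[of "1 / t" "smult t g"] t by (simp add: field_simps)
    then show ?thesis using half[OF t, of g] by simp
  qed
qed

text \<open>
  A sequence dominated by the support function lies in the ball: testing with \<open>c\<^sub>k = w\<^sub>k\<^sup>s\<^sup>-\<^sup>1\<close>, the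
  extremal sequence in the duality of \<open>\<ell>\<^sup>s\<close>, and Young's inequality give
  \<open>S \<le> 1 / s + (1 - 1 / s) S\<close> for \<open>S = \<Sum> w\<^sub>k\<^sup>s\<close>.
\<close>

lemma dominated_weights:
  assumes s: "1 \<le> s" and nonneg: "\<And>k. 0 \<le> w k"
    and dom: "\<And>n c. (\<Sum>k<n. w k * c k) \<le> support_function s (\<Sum>k<n. monom (c k) k)"
  shows "w \<in> weight_ball s"
proof -
  have "(\<Sum>k<n. w k powr s) \<le> 1" for n
  proof -
    define S where "S = (\<Sum>k<n. w k powr s)"
    have young: "v k * w k powr (s - 1) \<le> (1 / s) * v k powr s + (1 - 1 / s) * w k powr s"
      if v: "\<And>k. 0 \<le> v k" for v :: "nat \<Rightarrow> real" and k
    proof (cases "v k = 0 \<or> w k = 0")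
      case True
      have "0 \<le> (1 / s) * v k powr s + (1 - 1 / s) * w k powr s" using s by simp
      then show ?thesis using True by auto
    next
      case False
      then have pos: "0 < v k" "0 < w k" using v nonneg by (auto simp: less_le)
      have "(v k powr s) powr (1 / s) * (w k powr s) powr (1 - 1 / s)
          \<le> (1 / s) * v k powr s + (1 - 1 / s) * w k powr s"
        by (rule Youngs_inequality_0) (use s pos in auto)
      moreover have "(v k powr s) powr (1 / s) = v k" using s pos by (simp add: powr_powr)
      moreover have "(w k powr s) powr (1 - 1 / s) = w k powr (s - 1)"
        using s by (simp add: powr_powr right_diff_distrib)
      ultimately show ?thesis by simp
    qed
    define g where "g = (\<Sum>k<n. monom (w k powr (s - 1)) k)"
    have cg: "coeff g k = (if k < n then w k powr (s - 1) else 0)" for k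
      by (simp add: g_def coeff_sum)
    have "S = (\<Sum>k<n. w k * w k powr (s - 1))"
      unfolding S_def
    proof (intro sum.cong refl)
      fix k show "w k powr s = w k * w k powr (s - 1)"
        using powr_add[of "w k" 1 "s - 1"] nonneg[of k] by (cases "w k = 0") auto
    qed
    also have "\<dots> \<le> support_function s g" unfolding g_def by (rule dom)
    also have "\<dots> \<le> 1 / s + (1 - 1 / s) * S"
    proof (rule support_function_le)
      fix v assume v: "v \<in> weight_ball s"
      then have v0: "0 \<le> v k" for k by (simp add: weight_ball_def)
      define m where "m = max n (Suc (degree g))"
      have "pairing v g = (\<Sum>k<m. v k * coeff g k)" by (rule pairing_eq) (simp add: m_def)
      also have "\<dots> = (\<Sum>k<n. v k * coeff g k)"
        by (rule sum.mono_neutral_right) (auto simp: m_def cg)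
      also have "\<dots> \<le> (\<Sum>k<n. (1 / s) * v k powr s + (1 - 1 / s) * w k powr s)"
        using young[OF v0] by (intro sum_mono) (simp add: cg)
      also have "\<dots> = (1 / s) * (\<Sum>k<n. v k powr s) + (1 - 1 / s) * S"
        by (simp add: sum.distrib sum_distrib_left S_def)
      also have "\<dots> \<le> (1 / s) * 1 + (1 - 1 / s) * S"
        using s v by (intro add_right_mono mult_left_mono) (auto simp: weight_ball_def)
      finally show "pairing v g \<le> 1 / s + (1 - 1 / s) * S" by simp
    qed
    finally have "(1 / s) * S \<le> (1 / s) * 1" by (simp add: algebra_simps)
    then show ?thesis using s by (simp add: S_def divide_le_cancel)
  qed
  then show ?thesis using nonneg by (simp add: weight_ball_def)
qed

text \<open>
  A change of density: an operator satisfying a 2-convexity estimate is continuous for a single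
  weighted \<open>\<ell>\<^sup>2\<close> norm. The pairs formed by the sum of the squares of a finite family and the sum of the
  squared norms of its images make up a convex cone, since families can be concatenated and
  multiplied by scalars. The sandwich theorem yields a linear functional between the two sides; its
  values at the unit sequences are the weights.
\<close>

theorem Maurey_weights:
  fixes u :: "nat \<Rightarrow> 'x::real_normed_vector"
  assumes s: "1 \<le> s" and L: "0 < L"
    and convex: "\<And>cs. (\<Sum>c\<leftarrow>cs. (norm (combination u c))\<^sup>2)
                   \<le> L * support_function s (\<Sum>c\<leftarrow>cs. coeff_square c)"
  obtains w where "w \<in> weight_ball s"
    "\<And>n c. (norm (\<Sum>k<n. c k *\<^sub>R u k))\<^sup>2 \<le> L * (\<Sum>k<n. (c k)\<^sup>2 * w k)"
proof -
  define P where
    "P = {(\<Sum>c\<leftarrow>cs. coeff_square c, (\<Sum>c\<leftarrow>cs. (norm (combination u c))\<^sup>2) / L) | cs. True}"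
  have P: "(\<Sum>c\<leftarrow>cs. coeff_square c, (\<Sum>c\<leftarrow>cs. (norm (combination u c))\<^sup>2) / L) \<in> P" for cs
    unfolding P_def by blast
  obtain W where W: "Vector_Spaces.linear smult (*) W" "\<And>g. W g \<le> support_function s g"
      "\<And>v r. (v, r) \<in> P \<Longrightarrow> r \<le> W v"
  proof (rule Hahn_Banach_sandwich[OF vector_space_smult sublinear_support_function[OF s], of P])
    show "(0, 0) \<in> P" using P[of "[]"] by simp
    show "(v + v', r + r') \<in> P" if m: "(v, r) \<in> P" and m': "(v', r') \<in> P" for v r v' r'
    proof -
      obtain cs where "v = (\<Sum>c\<leftarrow>cs. coeff_square c)" "r = (\<Sum>c\<leftarrow>cs. (norm (combination u c))\<^sup>2) / L"
        using m unfolding P_def by blast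
      moreover obtain cs' where "v' = (\<Sum>c\<leftarrow>cs'. coeff_square c)"
          "r' = (\<Sum>c\<leftarrow>cs'. (norm (combination u c))\<^sup>2) / L"
        using m' unfolding P_def by blast
      ultimately show ?thesis using P[of "cs @ cs'"] by (simp add: add_divide_distrib)
    qed
    show "(smult t v, t * r) \<in> P" if m: "(v, r) \<in> P" and t: "0 < t" for v r t
    proof -
      obtain cs where v: "v = (\<Sum>c\<leftarrow>cs. coeff_square c)"
        and r: "r = (\<Sum>c\<leftarrow>cs. (norm (combination u c))\<^sup>2) / L"
        using m unfolding P_def by blast
      have "(\<Sum>c\<leftarrow>map (smult (sqrt t)) cs. coeff_square c) = smult t v"
        using t by (simp add: v smult_sum_list coeff_square_smult o_def)
      moreover have "(\<Sum>c\<leftarrow>map (smult (sqrt t)) cs. (norm (combination u c))\<^sup>2) / L = t * r"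
        using t by (simp add: r combination_smult o_def power_mult_distrib sum_list_const_mult)
      ultimately show ?thesis using P[of "map (smult (sqrt t)) cs"] by simp
    qed
    show "r \<le> support_function s v" if m: "(v, r) \<in> P" for v r
    proof -
      obtain cs where "v = (\<Sum>c\<leftarrow>cs. coeff_square c)" "r = (\<Sum>c\<leftarrow>cs. (norm (combination u c))\<^sup>2) / L"
        using m unfolding P_def by blast
      then show ?thesis using convex[of cs] L by (simp add: divide_le_eq mult.commute)
    qed
  qed blast
  interpret W: Vector_Spaces.linear smult "(*)" W by (rule W(1))
  define w where "w k = W (monom 1 k)" for k
  have W_monom: "W (monom a k) = a * w k" for a k
    using W.scale[of a "monom 1 k"] by (simp add: w_def smult_monom)
  have W_sum: "W (\<Sum>k<n. monom (c k) k) = (\<Sum>k<n. c k * w k)" for n c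
    by (simp add: W.sum W_monom)
  have "w \<in> weight_ball s"
  proof (rule dominated_weights[OF s])
    show "0 \<le> w k" for k
    proof -
      have "W (- monom 1 k) \<le> 0"
      proof (rule order_trans[OF W(2) support_function_le])
        fix v assume "v \<in> weight_ball s"
        then have v: "0 \<le> v j" for j by (simp add: weight_ball_def)
        show "pairing v (- monom 1 k) \<le> 0"
          unfolding pairing_def by (rule sum_nonpos) (use v in auto)
      qed
      then show ?thesis by (simp add: W.neg w_def)
    qed
    show "(\<Sum>k<n. w k * c k) \<le> support_function s (\<Sum>k<n. monom (c k) k)" for n c
      using W(2)[of "\<Sum>k<n. monom (c k) k"] unfolding W_sum by (simp add: mult.commute)
  qed
  moreover have "(norm (\<Sum>k<n. c k *\<^sub>R u k))\<^sup>2 \<le> L * (\<Sum>k<n. (c k)\<^sup>2 * w k)" for n c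
  proof -
    define g where "g = (\<Sum>k<n. monom (c k) k)"
    have cg: "coeff g k = (if k < n then c k else 0)" for k
      by (simp add: g_def coeff_sum)
    define m where "m = max n (Suc (degree g))"
    have "combination u g = (\<Sum>k<m. coeff g k *\<^sub>R u k)" by (rule combination_eq) (simp add: m_def)
    also have "\<dots> = (\<Sum>k<n. coeff g k *\<^sub>R u k)" by (rule sum.mono_neutral_right) (auto simp: m_def cg)
    finally have comb: "combination u g = (\<Sum>k<n. c k *\<^sub>R u k)" by (simp add: cg)
    have "coeff_square g = (\<Sum>k<n. monom ((c k)\<^sup>2) k)"
      by (rule poly_eqI) (simp add: cg coeff_sum)
    then have "W (coeff_square g) = (\<Sum>k<n. (c k)\<^sup>2 * w k)" by (simp add: W_sum)
    moreover have "(norm (combination u g))\<^sup>2 / L \<le> W (coeff_square g)"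
      using W(3)[OF P[of "[g]"]] by simp
    ultimately show ?thesis using L by (simp add: comb field_simps)
  qed
  ultimately show ?thesis using that by blast
qed

text \<open>
  The 2-convexity estimate for weakly \<open>p\<close>-summable sequences, reduced to the case of \<open>\<ell>\<^sub>\<infinity>\<close>. Dividing the
  coefficients by the root \<open>a\<close> of the sum of their squares gives a family whose squares have sum
  at most 1, at the price of replacing \<open>u\<^sub>k\<close> by \<open>a\<^sub>k u\<^sub>k\<close>. The latter sequence is weakly 1-summable
  with norm at most \<open>\<parallel>a\<parallel>\<close> in \<open>\<ell>\<^sup>p\<^sup>'\<close>.
\<close>

lemma cotype_2_square_function_estimate:
  fixes u :: "nat \<Rightarrow> 'x::real_normed_vector"
  assumes p: "1 \<le> p" "p < 2" and \<kappa>: "0 < \<kappa>"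
    and cotype: "\<And>m (y :: nat \<Rightarrow> 'x).
       (\<Sum>i<m. (norm (y i))\<^sup>2) \<le> \<kappa> * ((\<Sum>\<epsilon>\<in>signs m. (norm (\<Sum>i<m. \<epsilon> i *\<^sub>R y i))\<^sup>2) / 2 ^ m)"
    and weak: "\<And>\<phi> n. bounded_linear \<phi> \<Longrightarrow> (\<And>y. \<bar>\<phi> y\<bar> \<le> norm y) \<Longrightarrow> (\<Sum>k<n. \<bar>\<phi> (u k)\<bar> powr p) \<le> 1"
  shows "(\<Sum>c\<leftarrow>cs. (norm (combination u c))\<^sup>2)
    \<le> 48 * \<kappa>\<^sup>2 * support_function (p / (2 - p)) (\<Sum>c\<leftarrow>cs. coeff_square c)"
proof -
  define s where "s = p / (2 - p)"
  have s: "1 \<le> s" using p by (simp add: s_def)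
  define G where "G = (\<Sum>c\<leftarrow>cs. coeff_square c)"
  define n where "n = Suc (Max (degree ` insert G (set cs)))"
  have deg: "degree c < n" if "c \<in> insert G (set cs)" for c
    unfolding n_def less_Suc_eq_le by (rule Max_ge) (use that in auto)
  have G: "coeff G k = (\<Sum>i<length cs. (coeff (cs ! i) k)\<^sup>2)" for k
    unfolding G_def coeff_sum_list by (simp add: sum_list_sum_nth atLeast0LessThan)
  have G0: "0 \<le> coeff G k" for k by (simp add: G sum_nonneg)
  define N where "N = support_function s G"
  have N0: "0 \<le> N"
    using pairing_le_support_function[OF s weight_ball_zero, of G] by (simp add: N_def pairing_def)
  define a where "a k = sqrt (coeff G k)" for k
  have a0: "0 \<le> a k" and a2: "(a k)\<^sup>2 = coeff G k" for k using G0 by (simp_all add: a_def)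
  define c where "c i k = coeff (cs ! i) k / a k" for i k
  have ca: "c i k * a k = coeff (cs ! i) k" if "i < length cs" for i k
  proof (cases "a k = 0")
    case True
    then have "(\<Sum>i<length cs. (coeff (cs ! i) k)\<^sup>2) = 0" using a2[of k] by (simp add: G)
    then have "(coeff (cs ! i) k)\<^sup>2 = 0"
      using that by (subst (asm) sum_nonneg_eq_0_iff) auto
    then show ?thesis using True by simp
  qed (simp add: c_def)
  have "(\<Sum>i<length cs. (norm (\<Sum>k<n. c i k *\<^sub>R (a k *\<^sub>R u k)))\<^sup>2) \<le> 48 * \<kappa>\<^sup>2 * (sqrt N)\<^sup>2"
  proof (rule cotype_2_two_summing[OF \<kappa> cotype])
    show "0 \<le> sqrt N" using N0 by simp
    show "(\<Sum>i<length cs. (c i k)\<^sup>2) \<le> 1" for k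
      by (simp add: c_def power_divide sum_divide_distrib[symmetric] a2 G divide_le_eq)
    fix d :: "nat \<Rightarrow> real" assume d: "\<And>k. k < n \<Longrightarrow> \<bar>d k\<bar> \<le> 1"
    define v where "v = (\<Sum>k<n. d k *\<^sub>R (a k *\<^sub>R u k))"
    obtain \<phi> where \<phi>: "bounded_linear \<phi>" "\<And>y. \<bar>\<phi> y\<bar> \<le> norm y" "\<phi> v = norm v"
      using norming_functional[of v] by blast
    interpret \<phi>: bounded_linear \<phi> by fact
    define b where "b k = \<bar>\<phi> (u k)\<bar>" for k
    \<comment> \<open>The weight for which Cauchy-Schwarz splits \<open>a\<^sub>k b\<^sub>k\<close> into \<open>w\<^sub>k a\<^sub>k\<^sup>2\<close> and \<open>b\<^sub>k\<^sup>p\<close>; it lies in the ball because \<open>s (2 - p) = p\<close>.\<close>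
    define w where "w k = (if k < n then b k powr (2 - p) else 0)" for k
    have w: "w \<in> weight_ball s"
      unfolding weight_ball_def
    proof (intro CollectI conjI allI)
      show "0 \<le> w k" for k by (simp add: w_def)
      fix m :: nat
      have "(\<Sum>k<m. w k powr s) \<le> (\<Sum>k<m. b k powr p)"
        using p by (intro sum_mono) (simp add: w_def powr_powr s_def)
      also have "\<dots> \<le> 1" unfolding b_def by (rule weak[OF \<phi>(1,2)])
      finally show "(\<Sum>k<m. w k powr s) \<le> 1" .
    qed
    have "norm v = (\<Sum>k<n. d k * (a k * \<phi> (u k)))"
      unfolding \<phi>(3)[symmetric] unfolding v_def by (simp add: \<phi>.sum \<phi>.scaleR mult.assoc)
    also have "\<dots> \<le> (\<Sum>k<n. a k * b k)"
    proof (rule sum_mono)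
      fix k assume "k \<in> {..<n}"
      have "d k * (a k * \<phi> (u k)) \<le> \<bar>d k\<bar> * (a k * b k)"
        using a0[of k] abs_ge_self[of "d k * (a k * \<phi> (u k))"] by (simp add: abs_mult b_def)
      also have "\<dots> \<le> 1 * (a k * b k)"
        using d \<open>k \<in> {..<n}\<close> a0[of k] by (intro mult_right_mono) (auto simp: b_def)
      finally show "d k * (a k * \<phi> (u k)) \<le> a k * b k" by simp
    qed
    finally have "(norm v)\<^sup>2 \<le> (\<Sum>k<n. a k * b k)\<^sup>2" by (intro power_mono) auto
    also have "(\<Sum>k<n. a k * b k) = (\<Sum>k<n. (a k * b k powr ((2 - p) / 2)) * b k powr (p / 2))"
    proof (intro sum.cong refl)
      fix k
      have "b k powr ((2 - p) / 2) * b k powr (p / 2) = b k"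
        unfolding powr_add[symmetric] by (simp add: b_def add_divide_distrib[symmetric])
      then show "a k * b k = (a k * b k powr ((2 - p) / 2)) * b k powr (p / 2)"
        by (simp add: mult.assoc)
    qed
    also have "\<dots>\<^sup>2 \<le> (\<Sum>k<n. (a k * b k powr ((2 - p) / 2))\<^sup>2) * (\<Sum>k<n. (b k powr (p / 2))\<^sup>2)"
      by (rule Cauchy_Schwarz_ineq_sum)
    also have "(\<Sum>k<n. (a k * b k powr ((2 - p) / 2))\<^sup>2) = pairing w G"
      unfolding pairing_eq[OF deg[of G, simplified]]
    proof (intro sum.cong refl)
      fix k assume "k \<in> {..<n}"
      have "(b k powr ((2 - p) / 2))\<^sup>2 = b k powr (2 - p)"
        by (simp add: power2_eq_square powr_add[symmetric])
      then show "(a k * b k powr ((2 - p) / 2))\<^sup>2 = w k * coeff G k"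
        using \<open>k \<in> {..<n}\<close> by (simp add: power_mult_distrib a2 w_def)
    qed
    also have "(\<Sum>k<n. (b k powr (p / 2))\<^sup>2) = (\<Sum>k<n. b k powr p)"
      by (intro sum.cong refl) (simp add: power2_eq_square powr_add[symmetric])
    also have "pairing w G * (\<Sum>k<n. b k powr p) \<le> N * 1"
      using pairing_le_support_function[OF s w, of G] weak[OF \<phi>(1,2)] N0
      by (intro mult_mono) (auto simp: N_def b_def sum_nonneg)
    finally show "norm v \<le> sqrt N" by (simp add: real_le_rsqrt)
  qed
  moreover have "(\<Sum>i<length cs. (norm (\<Sum>k<n. c i k *\<^sub>R (a k *\<^sub>R u k)))\<^sup>2)
      = (\<Sum>i<length cs. (norm (combination u (cs ! i)))\<^sup>2)"
  proof (intro sum.cong refl)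
    fix i assume i: "i \<in> {..<length cs}"
    then have "degree (cs ! i) < n" by (intro deg) auto
    then show "(norm (\<Sum>k<n. c i k *\<^sub>R (a k *\<^sub>R u k)))\<^sup>2 = (norm (combination u (cs ! i)))\<^sup>2"
      using i by (simp add: combination_eq ca)
  qed
  moreover have "(\<Sum>c\<leftarrow>cs. (norm (combination u c))\<^sup>2) = (\<Sum>i<length cs. (norm (combination u (cs ! i)))\<^sup>2)"
    by (simp add: sum_list_sum_nth atLeast0LessThan)
  ultimately show ?thesis using N0 by (simp add: N_def G_def s_def)
qed

section \<open>Finite-rank approximation along a Bessel sequence\<close>

abbreviation square_summable :: "(nat \<Rightarrow> real) \<Rightarrow> bool" where
  "square_summable f \<equiv> summable (\<lambda>k. (f k)\<^sup>2)"

definition l2_inner :: "(nat \<Rightarrow> real) \<Rightarrow> (nat \<Rightarrow> real) \<Rightarrow> real" where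
  "l2_inner f g = (\<Sum>k. f k * g k)"

lemma summable_l2_inner:
  assumes "square_summable f" "square_summable g"
  shows "summable (\<lambda>k. f k * g k)"
proof (rule summable_comparison_test'[where N = 0])
  show "summable (\<lambda>k. (f k)\<^sup>2 + (g k)\<^sup>2)" using assms by (rule summable_add)
  fix k
  have "2 * (\<bar>f k\<bar> * \<bar>g k\<bar>) \<le> (f k)\<^sup>2 + (g k)\<^sup>2"
    using zero_le_power2[of "\<bar>f k\<bar> - \<bar>g k\<bar>"] by (simp add: power2_diff)
  moreover have "0 \<le> \<bar>f k\<bar> * \<bar>g k\<bar>" by simp
  ultimately show "norm (f k * g k) \<le> (f k)\<^sup>2 + (g k)\<^sup>2"
    unfolding real_norm_def abs_mult by linarith
qed

lemma l2_inner_commute: "l2_inner f g = l2_inner g f"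
  by (simp add: l2_inner_def mult.commute)

lemma l2_inner_scale: 
  assumes "square_summable f" "square_summable g"
  shows "l2_inner (\<lambda>k. t * f k) g = t * l2_inner f g"
  using suminf_mult[OF summable_l2_inner[OF assms], of t] by (simp add: l2_inner_def mult.assoc)

lemma l2_inner_diff:
  assumes "square_summable f" "square_summable g" "square_summable h"
  shows "l2_inner (\<lambda>k. f k - g k) h = l2_inner f h - l2_inner g h"
  using suminf_diff[OF summable_l2_inner[OF assms(1,3)] summable_l2_inner[OF assms(2,3)]]
  by (simp add: l2_inner_def left_diff_distrib)

lemma l2_inner_sum:
  assumes "\<And>i. i < m \<Longrightarrow> square_summable (g i)" "square_summable h"
  shows "l2_inner (\<lambda>k. \<Sum>i<m. c i * g i k) h = (\<Sum>i<m. c i * l2_inner (g i) h)"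
proof -
  have "(\<Sum>k. \<Sum>i<m. c i * (g i k * h k)) = (\<Sum>i<m. \<Sum>k. c i * (g i k * h k))"
    by (rule suminf_sum) (use assms in \<open>auto intro: summable_mult summable_l2_inner\<close>)
  also have "\<dots> = (\<Sum>i<m. c i * l2_inner (g i) h)"
    unfolding l2_inner_def using assms by (intro sum.cong refl suminf_mult summable_l2_inner) auto
  finally show ?thesis by (simp add: l2_inner_def sum_distrib_right mult.assoc)
qed

lemma sum_squares_le_l2_inner:
  assumes "square_summable f" "finite A"
  shows "(\<Sum>k\<in>A. (f k)\<^sup>2) \<le> l2_inner f f"
  using sum_le_suminf[OF assms] by (simp add: l2_inner_def power2_eq_square)

text \<open>
  A finite orthonormal system in \<open>V\<close> that nearly maximizes the sum of the squared norms of the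
  projections of the first \<open>N\<close> unit vectors. If the residual of \<open>h\<close> is nonzero, then its normalization
  extends the system, so near-maximality bounds the first \<open>N\<close> entries of the residual. This replaces
  the orthogonal projection onto the closure of \<open>V\<close>, but the system consists of elements of \<open>V\<close>
  itself; for the application it matters that these come from functionals on the Banach space.
\<close>

lemma near_maximal_orthonormal_system:
  fixes V :: "(nat \<Rightarrow> real) set"
  assumes zero: "(\<lambda>_. 0) \<in> V"
    and lin: "\<And>f g t. f \<in> V \<Longrightarrow> g \<in> V \<Longrightarrow> (\<lambda>k. f k + t * g k) \<in> V"
    and sq: "\<And>f. f \<in> V \<Longrightarrow> square_summable f"
    and \<delta>: "0 < \<delta>"
  obtains m :: nat and g where "\<And>i. i < m \<Longrightarrow> g i \<in> V"
    and "\<And>h n. h \<in> V \<Longrightarrow>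
      (\<Sum>k<n. (h k - (\<Sum>i<m. l2_inner (g i) h * g i k))\<^sup>2) \<le> l2_inner h h"
    and "\<And>h k. h \<in> V \<Longrightarrow> k < N \<Longrightarrow>
      (h k - (\<Sum>i<m. l2_inner (g i) h * g i k))\<^sup>2 \<le> \<delta> * l2_inner h h"
proof -
  define ON where "ON m g \<longleftrightarrow> (\<forall>i<m. g i \<in> V) \<and>
      (\<forall>i<m. \<forall>j<m. l2_inner (g i) (g j) = (if i = j then 1 else 0))" for m :: nat and g
  define E where "E m g = (\<Sum>i<m. \<Sum>k<N. (g i k)\<^sup>2)" for m :: nat and g :: "nat \<Rightarrow> nat \<Rightarrow> real"
  have scale: "(\<lambda>k. t * f k) \<in> V" if "f \<in> V" for f t
    using lin[OF zero that, of t] by simp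
  have sum_V: "(\<lambda>k. \<Sum>i<m. c i * g i k) \<in> V" if "\<And>i. i < m \<Longrightarrow> g i \<in> V" for m :: nat and c g
    using that
  proof (induction m)
    case (Suc m)
    then have "(\<lambda>k. (\<Sum>i<m. c i * g i k) + c m * g m k) \<in> V" by (intro lin) auto
    then show ?case by simp
  qed (use zero in simp)
  \<comment> \<open>Bessel's inequality for the \<open>k\<close>-th unit vector, whose projection onto the system is \<open>v\<close>.\<close>
  have bessel: "(\<Sum>i<m. (g i k)\<^sup>2) \<le> 1" if on: "ON m g" for m g k
  proof -
    have gV: "g i \<in> V" if "i < m" for i using on that by (simp add: ON_def)
    define v where "v j = (\<Sum>i<m. g i k * g i j)" for j
    have vV: "v \<in> V" unfolding v_def by (rule sum_V) (rule gV)
    have "l2_inner (g i) v = g i k" if i: "i < m" for i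
    proof -
      have "l2_inner v (g i) = (\<Sum>j<m. g j k * l2_inner (g j) (g i))"
        unfolding v_def by (rule l2_inner_sum) (use gV sq i in auto)
      also have "\<dots> = (\<Sum>j<m. if j = i then g j k else 0)"
        by (rule sum.cong) (use on i in \<open>auto simp: ON_def\<close>)
      also have "\<dots> = g i k" using i by simp
      finally show ?thesis by (simp add: l2_inner_commute)
    qed
    then have "l2_inner v v = (\<Sum>i<m. (g i k)\<^sup>2)"
      using l2_inner_sum[of m g v "\<lambda>i. g i k"] gV sq vV
      by (simp add: v_def[symmetric] power2_eq_square)
    moreover have "(v k)\<^sup>2 \<le> l2_inner v v"
      using sum_squares_le_l2_inner[OF sq[OF vV], of "{k}"] by simp
    moreover have "v k = (\<Sum>i<m. (g i k)\<^sup>2)" by (simp add: v_def power2_eq_square)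
    ultimately have s: "(\<Sum>i<m. (g i k)\<^sup>2)\<^sup>2 \<le> (\<Sum>i<m. (g i k)\<^sup>2)" by simp
    show ?thesis
    proof (rule ccontr)
      assume "\<not> ?thesis"
      then have "1 * (\<Sum>i<m. (g i k)\<^sup>2) < (\<Sum>i<m. (g i k)\<^sup>2) * (\<Sum>i<m. (g i k)\<^sup>2)"
        by (intro mult_strict_right_mono) auto
      then show False using s by (simp add: power2_eq_square)
    qed
  qed
  define S where "S = {E m g | m g. ON m g}"
  have E_in: "E m g \<in> S" if "ON m g" for m g using that unfolding S_def by blast
  have bdd: "bdd_above S"
  proof (rule bdd_aboveI)
    fix a assume "a \<in> S"
    then obtain m g where a: "a = E m g" and on: "ON m g" unfolding S_def by blast
    have "a = (\<Sum>k<N. \<Sum>i<m. (g i k)\<^sup>2)" unfolding a E_def by (rule sum.swap)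
    also have "\<dots> \<le> (\<Sum>k<N. 1)" by (intro sum_mono bessel on)
    finally show "a \<le> N" by simp
  qed
  have ne: "S \<noteq> {}" using E_in[of 0] by (auto simp: ON_def)
  have "Sup S - \<delta> < Sup S" using \<delta> by simp
  then obtain a where "a \<in> S" "Sup S - \<delta> < a" using less_cSup_iff[OF ne bdd] by blast
  then obtain m g where on: "ON m g" and max: "Sup S - \<delta> < E m g" unfolding S_def by blast
  have gV: "g i \<in> V" if "i < m" for i using on that by (simp add: ON_def)
  have *: "(\<Sum>k<n. (h k - (\<Sum>i<m. l2_inner (g i) h * g i k))\<^sup>2) \<le> l2_inner h h \<and>
    (j < N \<longrightarrow> (h j - (\<Sum>i<m. l2_inner (g i) h * g i j))\<^sup>2 \<le> \<delta> * l2_inner h h)"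
    if h: "h \<in> V" for h n j
  proof -
    define f where "f k = (\<Sum>i<m. l2_inner (g i) h * g i k)" for k
    define h' where "h' k = h k - f k" for k
    have fV: "f \<in> V" unfolding f_def by (rule sum_V) (rule gV)
    have h'V: "h' \<in> V" using lin[OF h fV, of "- 1"] by (simp add: h'_def[abs_def])
    have f_inner: "l2_inner f v = (\<Sum>i<m. l2_inner (g i) h * l2_inner (g i) v)" if "v \<in> V" for v
      unfolding f_def by (rule l2_inner_sum) (use gV sq that in auto)
    have h'_inner: "l2_inner h' v = l2_inner h v - l2_inner f v" if "v \<in> V" for v
      unfolding h'_def[abs_def] by (rule l2_inner_diff) (use sq h fV that in auto)
    have orth: "l2_inner h' (g i) = 0" if i: "i < m" for i
    proof -
      have "l2_inner f (g i) = (\<Sum>j<m. if j = i then l2_inner (g j) h else 0)"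
        unfolding f_inner[OF gV[OF i]]
        by (rule sum.cong) (use on i in \<open>auto simp: ON_def\<close>)
      also have "\<dots> = l2_inner (g i) h" using i by simp
      finally show ?thesis using h'_inner[OF gV[OF i]] by (simp add: l2_inner_commute)
    qed
    have "l2_inner f h' = 0"
      unfolding f_inner[OF h'V] by (rule sum.neutral) (simp add: l2_inner_commute[of "g _" h'] orth)
    then have "l2_inner h' h' = l2_inner h h - l2_inner f h"
      using h'_inner[OF h'V] h'_inner[OF h] by (simp add: l2_inner_commute)
    moreover have "0 \<le> l2_inner f h"
      unfolding f_inner[OF h] by (simp add: sum_nonneg)
    ultimately have le: "l2_inner h' h' \<le> l2_inner h h" by simp
    define b where "b = l2_inner h' h'"
    have point: "(h' k)\<^sup>2 \<le> b" for k
      unfolding b_def using sum_squares_le_l2_inner[OF sq[OF h'V], of "{k}"] by simp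
    have "(h' j)\<^sup>2 \<le> \<delta> * l2_inner h h" if j: "j < N"
    proof (cases "b = 0")
      case True
      then have "(h' j)\<^sup>2 \<le> 0" "0 \<le> \<delta> * l2_inner h h"
        using point[of j] le \<delta> by (simp_all add: b_def)
      then show ?thesis by linarith
    next
      case False
      have "0 \<le> b" by (rule order_trans[OF _ point[of 0]]) simp
      with False have b: "0 < b" by simp
      define e where "e k = (1 / sqrt b) * h' k" for k
      have eV: "e \<in> V" unfolding e_def by (rule scale[OF h'V])
      have e_inner: "l2_inner e v = (1 / sqrt b) * l2_inner h' v" if "v \<in> V" for v
        unfolding e_def by (rule l2_inner_scale) (use sq h'V that in auto)
      have ee: "l2_inner e e = 1"
        using e_inner[OF eV] e_inner[OF h'V] b
        by (simp add: l2_inner_commute[of h' e] b_def[symmetric])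
      have eg: "l2_inner e (g i) = 0" if "i < m" for i
        using e_inner[OF gV[OF that]] orth[OF that] by simp
      then have ge: "l2_inner (g i) e = 0" if "i < m" for i
        using that by (simp add: l2_inner_commute)
      have ON: "ON (Suc m) (g(m := e))"
        unfolding ON_def
      proof (intro conjI allI impI)
        show "(g(m := e)) i \<in> V" if "i < Suc m" for i
          using that eV gV by (auto simp: less_Suc_eq)
        show "l2_inner ((g(m := e)) i) ((g(m := e)) j) = (if i = j then 1 else 0)"
          if "i < Suc m" "j < Suc m" for i j
          using that on ee eg ge by (auto simp: less_Suc_eq ON_def)
      qed
      have "E (Suc m) (g(m := e)) = E m g + (\<Sum>k<N. (e k)\<^sup>2)"
      proof -
        have "(\<Sum>i<m. \<Sum>k<N. ((g(m := e)) i k)\<^sup>2) = E m g"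
          unfolding E_def by (rule sum.cong) auto
        then show ?thesis by (simp add: E_def)
      qed
      moreover have "E (Suc m) (g(m := e)) \<le> Sup S" by (rule cSup_upper[OF E_in[OF ON] bdd])
      ultimately have "(\<Sum>k<N. (e k)\<^sup>2) \<le> \<delta>" using max by simp
      moreover have "(e j)\<^sup>2 \<le> (\<Sum>k<N. (e k)\<^sup>2)" using j by (intro member_le_sum) auto
      ultimately have "(e j)\<^sup>2 \<le> \<delta>" by simp
      then have "(h' j)\<^sup>2 \<le> \<delta> * b" using b by (simp add: e_def power_mult_distrib power_divide field_simps)
      also have "\<dots> \<le> \<delta> * l2_inner h h" using le \<delta> by (simp add: b_def)
      finally show ?thesis .
    qed
    moreover have "(\<Sum>k<n. (h' k)\<^sup>2) \<le> l2_inner h h"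
      using sum_squares_le_l2_inner[OF sq[OF h'V], of "{..<n}"] le by simp
    ultimately show ?thesis by (simp add: h'_def f_def)
  qed
  show ?thesis
    by (rule that[of m g]) (use gV * in auto)
qed

text \<open>
  Let \<open>Q\<close> be the operator \<open>c \<mapsto> \<Sum> c\<^sub>k z\<^sub>k\<close> on \<open>\<ell>\<^sup>2\<close>; its adjoint sends \<open>\<phi>\<close> to the sequence \<open>\<phi> (z\<^sub>k)\<close>. If
  \<open>g\<^sub>i = (\<psi>\<^sub>i (z\<^sub>k))\<^sub>k\<close> is an orthonormal system in the range of the adjoint and \<open>Z\<^sub>i = Q g\<^sub>i\<close>, then
  \<open>A = \<Sum> \<psi>\<^sub>i \<otimes> Z\<^sub>i\<close> satisfies \<open>A Q = Q P\<close> for the orthogonal projection \<open>P\<close> onto the span of the system.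
  Hence the numbers \<open>\<phi> (z\<^sub>k - A z\<^sub>k)\<close> are the entries of the residual of the sequence \<open>\<phi> (z\<^sub>k)\<close>. Since \<open>P\<close>
  is a contraction, the first bound is uniform in \<open>N\<close> and \<open>\<delta>\<close>.
\<close>

lemma Bessel_sequence_finite_rank_approximation:
  fixes z :: "nat \<Rightarrow> 'x::banach"
  assumes bessel: "\<And>n c. (norm (\<Sum>k<n. c k *\<^sub>R z k))\<^sup>2 \<le> L * (\<Sum>k<n. (c k)\<^sup>2)"
    and \<delta>: "0 < \<delta>"
  obtains m :: nat and \<psi> :: "nat \<Rightarrow> 'x \<Rightarrow> real" and Z where "\<And>i. i < m \<Longrightarrow> bounded_linear (\<psi> i)"
    and "\<And>\<phi> n. bounded_linear \<phi> \<Longrightarrow> (\<And>y. \<bar>\<phi> y\<bar> \<le> norm y) \<Longrightarrow>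
           (\<Sum>k<n. (\<phi> (z k - (\<Sum>i<m. \<psi> i (z k) *\<^sub>R Z i)))\<^sup>2) \<le> L"
    and "\<And>\<phi> k. bounded_linear \<phi> \<Longrightarrow> (\<And>y. \<bar>\<phi> y\<bar> \<le> norm y) \<Longrightarrow> k < N \<Longrightarrow>
           (\<phi> (z k - (\<Sum>i<m. \<psi> i (z k) *\<^sub>R Z i)))\<^sup>2 \<le> \<delta> * L"
proof -
  define V where "V = {\<lambda>k. \<phi> (z k) | \<phi>. bounded_linear (\<phi> :: 'x \<Rightarrow> real)}"
  have V: "(\<lambda>k. \<phi> (z k)) \<in> V" if "bounded_linear \<phi>" for \<phi> :: "'x \<Rightarrow> real"
    using that unfolding V_def by blast
  have sum_le: "(\<Sum>k<n. (\<phi> (z k))\<^sup>2) \<le> C\<^sup>2 * L"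
    if \<phi>: "bounded_linear \<phi>" and C: "\<And>y. \<bar>\<phi> y\<bar> \<le> C * norm y" for \<phi> :: "'x \<Rightarrow> real" and C and n :: nat
  proof -
    interpret \<phi>: bounded_linear \<phi> by fact
    define S where "S = (\<Sum>k<n. (\<phi> (z k))\<^sup>2)"
    have S0: "0 \<le> S" by (simp add: S_def sum_nonneg)
    have "S = \<phi> (\<Sum>k<n. \<phi> (z k) *\<^sub>R z k)"
      by (simp add: S_def \<phi>.sum \<phi>.scaleR power2_eq_square)
    then have "S\<^sup>2 \<le> (C * norm (\<Sum>k<n. \<phi> (z k) *\<^sub>R z k))\<^sup>2"
      using C[of "\<Sum>k<n. \<phi> (z k) *\<^sub>R z k"] S0 by (intro power_mono) auto
    also have "\<dots> \<le> C\<^sup>2 * (L * S)"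
      unfolding power_mult_distrib S_def by (intro mult_left_mono bessel) simp
    finally have "S * S \<le> (C\<^sup>2 * L) * S" by (simp add: power2_eq_square mult_ac)
    moreover have "0 \<le> C\<^sup>2 * L" if "S = 0"
      using bessel[of "\<lambda>_. 1" 1] by (simp add: order_trans[OF zero_le_power2])
    ultimately have "S \<le> C\<^sup>2 * L" using S0 by (cases "S = 0") auto
    then show ?thesis by (simp add: S_def)
  qed
  have sq: "square_summable f" if fV: "f \<in> V" for f
  proof -
    obtain \<phi> :: "'x \<Rightarrow> real" where f: "f = (\<lambda>k. \<phi> (z k))" and \<phi>: "bounded_linear \<phi>"
      using fV unfolding V_def by blast
    obtain C where "\<And>y. norm (\<phi> y) \<le> norm y * C" using bounded_linear.bounded[OF \<phi>] by blast
    then have "(\<Sum>k<n. (f k)\<^sup>2) \<le> C\<^sup>2 * L" for n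
      unfolding f by (intro sum_le \<phi>) (simp add: mult.commute)
    then show ?thesis by (intro summableI_nonneg_bounded[where x = "C\<^sup>2 * L"]) auto
  qed
  obtain m :: nat and g where g: "\<And>i. i < m \<Longrightarrow> g i \<in> V"
    and res: "\<And>h n. h \<in> V \<Longrightarrow>
      (\<Sum>k<n. (h k - (\<Sum>i<m. l2_inner (g i) h * g i k))\<^sup>2) \<le> l2_inner h h"
    and resN: "\<And>h k. h \<in> V \<Longrightarrow> k < N \<Longrightarrow>
      (h k - (\<Sum>i<m. l2_inner (g i) h * g i k))\<^sup>2 \<le> \<delta> * l2_inner h h"
  proof (rule near_maximal_orthonormal_system[OF _ _ sq \<delta>, of V N])
    show "(\<lambda>_. 0) \<in> V" using V[OF bounded_linear_zero] by simp
    fix f h t assume "f \<in> V" "h \<in> V"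
    then obtain \<phi> \<phi>' :: "'x \<Rightarrow> real" where "f = (\<lambda>k. \<phi> (z k))" "bounded_linear \<phi>"
        "h = (\<lambda>k. \<phi>' (z k))" "bounded_linear \<phi>'"
      unfolding V_def by blast
    then show "(\<lambda>k. f k + t * h k) \<in> V"
      using V[of "\<lambda>x. \<phi> x + t * \<phi>' x"]
      by (simp add: bounded_linear_add bounded_linear_const_mult)
  next
    fix m :: nat and g :: "nat \<Rightarrow> nat \<Rightarrow> real"
    assume "\<And>i. i < m \<Longrightarrow> g i \<in> V"
      and "\<And>h n. h \<in> V \<Longrightarrow>
        (\<Sum>k<n. (h k - (\<Sum>i<m. l2_inner (g i) h * g i k))\<^sup>2) \<le> l2_inner h h"
      and "\<And>h k. h \<in> V \<Longrightarrow> k < N \<Longrightarrow>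
        (h k - (\<Sum>i<m. l2_inner (g i) h * g i k))\<^sup>2 \<le> \<delta> * l2_inner h h"
    then show thesis by (rule that)
  qed
  have "\<forall>i. \<exists>\<phi> :: 'x \<Rightarrow> real. i < m \<longrightarrow> g i = (\<lambda>k. \<phi> (z k)) \<and> bounded_linear \<phi>"
    using g unfolding V_def by blast
  then obtain \<psi> :: "nat \<Rightarrow> 'x \<Rightarrow> real"
    where \<psi>: "\<And>i. i < m \<Longrightarrow> g i = (\<lambda>k. \<psi> i (z k)) \<and> bounded_linear (\<psi> i)" by metis
  define Z where "Z i = (\<Sum>l. g i l *\<^sub>R z l)" for i
  have summ: "summable (\<lambda>l. g i l *\<^sub>R z l)" if i: "i < m" for i
    unfolding summable_Cauchy
  proof (intro allI impI)
    fix e :: real assume e: "0 < e"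
    define L' where "L' = max L 1"
    have L': "0 < L'" "L \<le> L'" by (auto simp: L'_def)
    have "0 < e\<^sup>2 / L'" using e L' by simp
    then obtain M where M: "\<And>a b. a \<ge> M \<Longrightarrow> norm (\<Sum>k\<in>{a..<b}. (g i k)\<^sup>2) < e\<^sup>2 / L'"
      using sq[OF g[OF i]] unfolding summable_Cauchy by blast
    have "norm (\<Sum>k\<in>{a..<b}. g i k *\<^sub>R z k) < e" if "a \<ge> M" for a b
    proof -
      define c where "c k = (if k < a then 0 else g i k)" for k
      have "(\<Sum>k\<in>{a..<b}. g i k *\<^sub>R z k) = (\<Sum>k<b. c k *\<^sub>R z k)"
        by (rule sum.mono_neutral_cong_left) (auto simp: c_def)
      moreover have "(\<Sum>k\<in>{a..<b}. (g i k)\<^sup>2) = (\<Sum>k<b. (c k)\<^sup>2)"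
        by (rule sum.mono_neutral_cong_left) (auto simp: c_def)
      ultimately have "(norm (\<Sum>k\<in>{a..<b}. g i k *\<^sub>R z k))\<^sup>2 \<le> L * (\<Sum>k\<in>{a..<b}. (g i k)\<^sup>2)"
        using bessel[of c b] by simp
      also have "\<dots> \<le> L' * (\<Sum>k\<in>{a..<b}. (g i k)\<^sup>2)"
        using L' by (intro mult_right_mono) (auto simp: sum_nonneg)
      also have "\<dots> < e\<^sup>2" using M[OF that, of b] L' by (simp add: sum_nonneg field_simps)
      finally show ?thesis using e by (simp add: power2_less_imp_less)
    qed
    then show "\<exists>M. \<forall>a\<ge>M. \<forall>b. norm (\<Sum>k\<in>{a..<b}. g i k *\<^sub>R z k) < e" by blast
  qed
  have eq: "\<phi> (z k - (\<Sum>i<m. \<psi> i (z k) *\<^sub>R Z i))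
      = \<phi> (z k) - (\<Sum>i<m. l2_inner (g i) (\<lambda>k. \<phi> (z k)) * g i k)"
    if \<phi>: "bounded_linear \<phi>" for \<phi> :: "'x \<Rightarrow> real" and k
  proof -
    interpret \<phi>: bounded_linear \<phi> by fact
    have "\<phi> (Z i) = l2_inner (g i) (\<lambda>k. \<phi> (z k))" if "i < m" for i
      using \<phi>.suminf[OF summ[OF that]] by (simp add: Z_def l2_inner_def \<phi>.scaleR)
    then have "(\<Sum>i<m. \<phi> (\<psi> i (z k) *\<^sub>R Z i)) = (\<Sum>i<m. l2_inner (g i) (\<lambda>k. \<phi> (z k)) * g i k)"
      by (intro sum.cong refl) (use \<psi> in \<open>auto simp: \<phi>.scaleR mult.commute\<close>)
    then show ?thesis by (simp add: \<phi>.diff \<phi>.sum)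
  qed
  have inner_le: "l2_inner (\<lambda>k. \<phi> (z k)) (\<lambda>k. \<phi> (z k)) \<le> L"
    if "bounded_linear \<phi>" "\<And>y. \<bar>\<phi> y\<bar> \<le> norm y" for \<phi> :: "'x \<Rightarrow> real"
    unfolding l2_inner_def power2_eq_square[symmetric]
    by (rule suminf_le_const[OF sq[OF V[OF that(1)]]]) (use sum_le[OF that(1), of 1] that(2) in simp)
  show ?thesis
  proof (rule that[of m \<psi> Z])
    show "bounded_linear (\<psi> i)" if "i < m" for i using \<psi>[OF that] by simp
    fix \<phi> :: "'x \<Rightarrow> real" assume \<phi>: "bounded_linear \<phi>" "\<And>y. \<bar>\<phi> y\<bar> \<le> norm y"
    show "(\<Sum>k<n. (\<phi> (z k - (\<Sum>i<m. \<psi> i (z k) *\<^sub>R Z i)))\<^sup>2) \<le> L" for n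
      unfolding eq[OF \<phi>(1)] by (rule order_trans[OF res[OF V[OF \<phi>(1)]] inner_le[OF \<phi>]])
    show "(\<phi> (z k - (\<Sum>i<m. \<psi> i (z k) *\<^sub>R Z i)))\<^sup>2 \<le> \<delta> * L" if "k < N" for k
      unfolding eq[OF \<phi>(1)]
      by (rule order_trans[OF resN[OF V[OF \<phi>(1)] that] mult_left_mono[OF inner_le[OF \<phi>]]])
        (use \<delta> in auto)
  qed
qed

section \<open>Approximation of weakly p-summable sequences\<close>

text \<open>
  The vectors \<open>z\<^sub>k = u\<^sub>k / \<surd>w\<^sub>k\<close> form a Bessel sequence, and \<open>u\<^sub>k = \<surd>w\<^sub>k z\<^sub>k\<close>. Young's inequality trades
  \<open>\<bar>\<surd>w\<^sub>k d\<^sub>k\<bar>\<^sup>p\<close> for \<open>\<tau> d\<^sub>k\<^sup>2 + \<tau>\<^sup>-\<^sup>s w\<^sub>k\<^sup>s\<close>. The first terms have total at most \<open>\<tau> L\<close>, the second ones are summable;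
  so a tail is small uniformly in the operator, and only finitely many entries remain to be made
  small.
\<close>

lemma weighted_finite_rank_approximation:
  fixes u :: "nat \<Rightarrow> 'x::banach"
  assumes p: "1 \<le> p" "p < 2" and L: "0 < L"
    and w: "w \<in> weight_ball (p / (2 - p))"
    and dom: "\<And>n c. (norm (\<Sum>k<n. c k *\<^sub>R u k))\<^sup>2 \<le> L * (\<Sum>k<n. (c k)\<^sup>2 * w k)"
    and \<epsilon>: "0 < \<epsilon>"
  obtains m :: nat and \<psi> :: "nat \<Rightarrow> 'x \<Rightarrow> real" and Z where "\<And>i. i < m \<Longrightarrow> bounded_linear (\<psi> i)"
    and "\<And>\<phi> n. bounded_linear \<phi> \<Longrightarrow> (\<And>y. \<bar>\<phi> y\<bar> \<le> norm y) \<Longrightarrow>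
           (\<Sum>k<n. \<bar>\<phi> (u k - (\<Sum>i<m. \<psi> i (u k) *\<^sub>R Z i))\<bar> powr p) \<le> \<epsilon>"
proof -
  define s where "s = p / (2 - p)"
  have s: "1 \<le> s" using p by (simp add: s_def)
  have w0: "0 \<le> w k" for k using w by (simp add: weight_ball_def)
  have w1: "w k \<le> 1" for k using weight_ball_le_1[OF s] w by (simp add: s_def)
  define z where "z k = (1 / sqrt (w k)) *\<^sub>R u k" for k
  have uz: "u k = sqrt (w k) *\<^sub>R z k" for k
  proof (cases "w k = 0")
    case True
    have "(\<Sum>j<Suc k. (if j = k then 1 else 0) *\<^sub>R u j) = u k"
      by (simp add: if_distrib[of "\<lambda>a. a *\<^sub>R _"] cong: if_cong)
    moreover have "(\<Sum>j<Suc k. (if j = k then 1 else 0)\<^sup>2 * w j) = w k"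
      by (simp add: if_distrib[of "\<lambda>a. a\<^sup>2"] if_distrib[of "\<lambda>a. a * _"] cong: if_cong)
    ultimately have "(norm (u k))\<^sup>2 \<le> L * w k"
      using dom[of "\<lambda>j. if j = k then 1 else 0" "Suc k"] by metis
    then show ?thesis using True by simp
  qed (simp add: z_def)
  have bessel: "(norm (\<Sum>k<n. c k *\<^sub>R z k))\<^sup>2 \<le> L * (\<Sum>k<n. (c k)\<^sup>2)" for n c
  proof -
    have "(norm (\<Sum>k<n. c k *\<^sub>R z k))\<^sup>2 \<le> L * (\<Sum>k<n. (c k / sqrt (w k))\<^sup>2 * w k)"
      using dom[of "\<lambda>k. c k / sqrt (w k)" n] by (simp add: z_def)
    also have "\<dots> \<le> L * (\<Sum>k<n. (c k)\<^sup>2)"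
      using L w0 by (intro mult_left_mono sum_mono) (auto simp: power_divide)
    finally show ?thesis .
  qed
  \<comment> \<open>\<open>\<tau>\<close> makes the quadratic part of the tail at most \<open>\<epsilon> / 4\<close>, and \<open>\<delta>\<close> below makes each of the \<open>N\<close> leading terms at most \<open>\<epsilon> / (2 (N + 1))\<close>.\<close>
  define \<tau> where "\<tau> = \<epsilon> / (4 * L)"
  have \<tau>: "0 < \<tau>" using \<epsilon> L by (simp add: \<tau>_def)
  have "summable (\<lambda>k. w k powr s)"
    by (rule summableI_nonneg_bounded[where x = 1]) (use w in \<open>auto simp: weight_ball_def s_def\<close>)
  then obtain N where N: "norm (\<Sum>k\<in>{a..<b}. w k powr s) < \<tau> powr s * (\<epsilon> / 4)" if "a \<ge> N" for a b
    unfolding summable_Cauchy using \<tau> \<epsilon> by (metis zero_less_mult_iff zero_less_divide_iff powr_gt_zero zero_less_numeral less_numeral_extra(3))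
  define \<delta> where "\<delta> = (\<epsilon> / (2 * (real N + 1))) powr (2 / p) / L"
  have \<delta>: "0 < \<delta>" using \<epsilon> L by (simp add: \<delta>_def)
  obtain m and \<psi> :: "nat \<Rightarrow> 'x \<Rightarrow> real" and Z where \<psi>: "\<And>i. i < m \<Longrightarrow> bounded_linear (\<psi> i)"
    and res: "\<And>\<phi> n. bounded_linear \<phi> \<Longrightarrow> (\<And>y. \<bar>\<phi> y\<bar> \<le> norm y) \<Longrightarrow>
           (\<Sum>k<n. (\<phi> (z k - (\<Sum>i<m. \<psi> i (z k) *\<^sub>R Z i)))\<^sup>2) \<le> L"
    and resN: "\<And>\<phi> k. bounded_linear \<phi> \<Longrightarrow> (\<And>y. \<bar>\<phi> y\<bar> \<le> norm y) \<Longrightarrow> k < N \<Longrightarrow>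
           (\<phi> (z k - (\<Sum>i<m. \<psi> i (z k) *\<^sub>R Z i)))\<^sup>2 \<le> \<delta> * L"
    by (rule Bessel_sequence_finite_rank_approximation[OF bessel \<delta>, where N = N]) blast
  show ?thesis
  proof (rule that[of m \<psi> Z])
    show "bounded_linear (\<psi> i)" if "i < m" for i using \<psi>[OF that] .
    fix \<phi> :: "'x \<Rightarrow> real" and n :: nat
    assume \<phi>: "bounded_linear \<phi>" "\<And>y. \<bar>\<phi> y\<bar> \<le> norm y"
    interpret \<phi>: bounded_linear \<phi> by fact
    define d where "d k = \<phi> (z k - (\<Sum>i<m. \<psi> i (z k) *\<^sub>R Z i))" for k
    have du: "\<phi> (u k - (\<Sum>i<m. \<psi> i (u k) *\<^sub>R Z i)) = sqrt (w k) * d k" for k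
    proof -
      have "\<psi> i (u k) = sqrt (w k) * \<psi> i (z k)" if "i < m" for i
        using linear_scale[OF bounded_linear.linear[OF \<psi>[OF that]]] by (subst uz) simp
      then have "u k - (\<Sum>i<m. \<psi> i (u k) *\<^sub>R Z i) = sqrt (w k) *\<^sub>R (z k - (\<Sum>i<m. \<psi> i (z k) *\<^sub>R Z i))"
        by (subst uz) (simp add: scaleR_diff_right scaleR_sum_right)
      then show ?thesis by (simp add: d_def \<phi>.scaleR)
    qed
    have head: "\<bar>sqrt (w k) * d k\<bar> powr p \<le> \<epsilon> / (2 * (real N + 1))" if k: "k < N" for k
    proof -
      have "\<bar>sqrt (w k) * d k\<bar> \<le> 1 * \<bar>d k\<bar>"
        unfolding abs_mult using w0[of k] w1[of k] by (intro mult_right_mono) auto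
      also have "\<bar>d k\<bar> = ((d k)\<^sup>2) powr (1 / 2)" by (simp add: powr_half_sqrt)
      also have "\<dots> \<le> (\<delta> * L) powr (1 / 2)"
        unfolding d_def using resN[OF \<phi> k] by (intro powr_mono2) auto
      finally have "\<bar>sqrt (w k) * d k\<bar> powr p \<le> ((\<delta> * L) powr (1 / 2)) powr p"
        using p by (intro powr_mono2) auto
      also have "\<dots> = \<epsilon> / (2 * (real N + 1))"
        using \<epsilon> L p by (simp add: \<delta>_def powr_powr)
      finally show ?thesis .
    qed
    have young: "\<bar>sqrt (w k) * d k\<bar> powr p \<le> \<tau> * (d k)\<^sup>2 + \<tau> powr (- s) * w k powr s" for k
    proof (cases "w k = 0 \<or> d k = 0")
      case True
      then show ?thesis using \<tau> by auto
    next
      case False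
      then have pos: "0 < w k" "0 < (d k)\<^sup>2" using w0[of k] by (auto simp: less_le)
      have e1: "s * (1 - p / 2) = p / 2" using p by (simp add: s_def field_simps)
      have "\<bar>sqrt (w k) * d k\<bar> = (w k) powr (1 / 2) * ((d k)\<^sup>2) powr (1 / 2)"
        using pos by (simp add: powr_half_sqrt abs_mult)
      moreover have "(x powr (1 / 2)) powr p = x powr (p / 2)" for x :: real
        by (subst powr_powr) simp
      ultimately have "\<bar>sqrt (w k) * d k\<bar> powr p = w k powr (p / 2) * ((d k)\<^sup>2) powr (p / 2)"
        by (simp only: powr_mult)
      also have "\<dots> = (\<tau> * (d k)\<^sup>2) powr (p / 2) * (\<tau> powr (- s) * w k powr s) powr (1 - p / 2)"
      proof -
        have e2: "- s * (1 - p / 2) = - (p / 2)" using e1 by (simp only: minus_mult_left[symmetric])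
        show ?thesis unfolding powr_mult powr_powr e1 e2 using \<tau> by (simp add: powr_minus)
      qed
      also have "\<dots> \<le> p / 2 * (\<tau> * (d k)\<^sup>2) + (1 - p / 2) * (\<tau> powr (- s) * w k powr s)"
        by (rule Youngs_inequality_0) (use p \<tau> pos in auto)
      also have "\<dots> \<le> 1 * (\<tau> * (d k)\<^sup>2) + 1 * (\<tau> powr (- s) * w k powr s)"
        using p \<tau> by (intro add_mono mult_right_mono) auto
      finally show ?thesis by simp
    qed
    have "(\<Sum>k<n. \<bar>sqrt (w k) * d k\<bar> powr p)
        \<le> (\<Sum>k<N. \<bar>sqrt (w k) * d k\<bar> powr p) + (\<Sum>k\<in>{N..<n}. \<bar>sqrt (w k) * d k\<bar> powr p)"
      by (subst sum.union_disjoint[symmetric]) (auto intro!: sum_mono2)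
    moreover have "(\<Sum>k<N. \<bar>sqrt (w k) * d k\<bar> powr p) \<le> \<epsilon> / 2"
    proof -
      have "(\<Sum>k<N. \<bar>sqrt (w k) * d k\<bar> powr p) \<le> (\<Sum>k<N. \<epsilon> / (2 * (real N + 1)))"
        by (rule sum_mono) (use head in auto)
      also have "\<dots> \<le> \<epsilon> / 2" using \<epsilon> by (simp add: field_simps)
      finally show ?thesis .
    qed
    moreover have "(\<Sum>k\<in>{N..<n}. \<bar>sqrt (w k) * d k\<bar> powr p) \<le> \<epsilon> / 2"
    proof -
      have "(\<Sum>k\<in>{N..<n}. \<bar>sqrt (w k) * d k\<bar> powr p)
          \<le> \<tau> * (\<Sum>k\<in>{N..<n}. (d k)\<^sup>2) + \<tau> powr (- s) * (\<Sum>k\<in>{N..<n}. w k powr s)"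
        unfolding sum_distrib_left sum.distrib[symmetric] by (intro sum_mono young)
      also have "\<dots> \<le> \<tau> * L + \<tau> powr (- s) * (\<tau> powr s * (\<epsilon> / 4))"
      proof (intro add_mono mult_left_mono)
        have "(\<Sum>k\<in>{N..<n}. (d k)\<^sup>2) \<le> (\<Sum>k<n. (d k)\<^sup>2)" by (rule sum_mono2) auto
        also have "\<dots> \<le> L" unfolding d_def by (rule res[OF \<phi>])
        finally show "(\<Sum>k\<in>{N..<n}. (d k)\<^sup>2) \<le> L" .
        show "(\<Sum>k\<in>{N..<n}. w k powr s) \<le> \<tau> powr s * (\<epsilon> / 4)"
          using N[of N n] by (simp add: sum_nonneg)
      qed (use \<tau> in auto)
      also have "\<dots> = \<epsilon> / 2" using \<tau> L by (simp add: \<tau>_def powr_minus field_simps)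
      finally show ?thesis .
    qed
    ultimately show "(\<Sum>k<n. \<bar>\<phi> (u k - (\<Sum>i<m. \<psi> i (u k) *\<^sub>R Z i))\<bar> powr p) \<le> \<epsilon>"
      unfolding du by linarith
  qed
qed

text \<open>
  The real form of the result. The bound \<open>B\<close> is first normalized to 1 by scaling \<open>u\<close>, which commutes
  with \<open>A\<close>.
\<close>

theorem cotype_2_finite_rank_approximation:
  fixes u :: "nat \<Rightarrow> 'x::banach"
  assumes cotype: "has_cotype TYPE('x) 2" and p: "1 \<le> p" "p < 2"
    and weak: "\<And>\<phi> n. bounded_linear \<phi> \<Longrightarrow> (\<And>y. \<bar>\<phi> y\<bar> \<le> norm y) \<Longrightarrow> (\<Sum>k<n. \<bar>\<phi> (u k)\<bar> powr p) \<le> B"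
    and \<epsilon>: "0 < \<epsilon>"
  obtains m :: nat and \<psi> :: "nat \<Rightarrow> 'x \<Rightarrow> real" and Z where "\<And>i. i < m \<Longrightarrow> bounded_linear (\<psi> i)"
    and "\<And>\<phi> n. bounded_linear \<phi> \<Longrightarrow> (\<And>y. \<bar>\<phi> y\<bar> \<le> norm y) \<Longrightarrow>
           (\<Sum>k<n. \<bar>\<phi> (u k - (\<Sum>i<m. \<psi> i (u k) *\<^sub>R Z i))\<bar> powr p) \<le> \<epsilon>"
proof -
  define b where "b = max B 1"
  have b: "0 < b" "B \<le> b" by (auto simp: b_def)
  define t where "t = b powr (- (1 / p))"
  have t: "0 < t" using b by (simp add: t_def)
  have tp: "t powr p = 1 / b"
    unfolding t_def powr_powr using b p by (simp add: powr_minus_divide)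
  define v where "v k = t *\<^sub>R u k" for k
  have scale: "(\<Sum>k<n. \<bar>t * f k\<bar> powr p) = (\<Sum>k<n. \<bar>f k\<bar> powr p) / b" for n :: nat and f
    using t by (simp add: abs_mult powr_mult tp sum_divide_distrib)
  obtain \<kappa> where \<kappa>: "0 < \<kappa>" and cot: "\<And>m (y :: nat \<Rightarrow> 'x).
       (\<Sum>i<m. (norm (y i))\<^sup>2) \<le> \<kappa> * ((\<Sum>\<epsilon>\<in>signs m. (norm (\<Sum>i<m. \<epsilon> i *\<^sub>R y i))\<^sup>2) / 2 ^ m)"
    using has_cotype_2E[OF cotype] by blast
  have weak_v: "(\<Sum>k<n. \<bar>\<phi> (v k)\<bar> powr p) \<le> 1"
    if \<phi>: "bounded_linear \<phi>" "\<And>y. \<bar>\<phi> y\<bar> \<le> norm y" for \<phi> and n :: nat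
  proof -
    interpret \<phi>: bounded_linear \<phi> by fact
    have "(\<Sum>k<n. \<bar>\<phi> (v k)\<bar> powr p) = (\<Sum>k<n. \<bar>\<phi> (u k)\<bar> powr p) / b"
      unfolding v_def \<phi>.scaleR real_scaleR_def by (rule scale)
    also have "\<dots> \<le> 1" using weak[OF \<phi>, of n] b by simp
    finally show ?thesis .
  qed
  have convex: "(\<Sum>c\<leftarrow>cs. (norm (combination v c))\<^sup>2)
      \<le> (48 * \<kappa>\<^sup>2) * support_function (p / (2 - p)) (\<Sum>c\<leftarrow>cs. coeff_square c)" for cs
    by (rule cotype_2_square_function_estimate[OF p \<kappa> cot]) (assumption | rule weak_v)+
  obtain w where w: "w \<in> weight_ball (p / (2 - p))"
    and dom: "\<And>n c. (norm (\<Sum>k<n. c k *\<^sub>R v k))\<^sup>2 \<le> (48 * \<kappa>\<^sup>2) * (\<Sum>k<n. (c k)\<^sup>2 * w k)"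
    by (rule Maurey_weights[of "p / (2 - p)" "48 * \<kappa>\<^sup>2" v])
      (use p \<kappa> convex in auto)
  have L: "0 < 48 * \<kappa>\<^sup>2" and \<epsilon>': "0 < \<epsilon> / b" using \<kappa> \<epsilon> b by simp_all
  obtain m and \<psi> :: "nat \<Rightarrow> 'x \<Rightarrow> real" and Z where \<psi>: "\<And>i. i < m \<Longrightarrow> bounded_linear (\<psi> i)"
    and res: "\<And>\<phi> n. bounded_linear \<phi> \<Longrightarrow> (\<And>y. \<bar>\<phi> y\<bar> \<le> norm y) \<Longrightarrow>
           (\<Sum>k<n. \<bar>\<phi> (v k - (\<Sum>i<m. \<psi> i (v k) *\<^sub>R Z i))\<bar> powr p) \<le> \<epsilon> / b"
    by (rule weighted_finite_rank_approximation[OF p L w dom \<epsilon>']) blast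
  show ?thesis
  proof (rule that[of m \<psi> Z])
    show "bounded_linear (\<psi> i)" if "i < m" for i using \<psi>[OF that] .
    fix \<phi> :: "'x \<Rightarrow> real" and n :: nat
    assume \<phi>: "bounded_linear \<phi>" "\<And>y. \<bar>\<phi> y\<bar> \<le> norm y"
    interpret \<phi>: bounded_linear \<phi> by fact
    have "\<phi> (v k - (\<Sum>i<m. \<psi> i (v k) *\<^sub>R Z i)) = t * \<phi> (u k - (\<Sum>i<m. \<psi> i (u k) *\<^sub>R Z i))" for k
    proof -
      have "\<psi> i (v k) = t * \<psi> i (u k)" if "i < m" for i
        using linear_scale[OF bounded_linear.linear[OF \<psi>[OF that]]] by (simp add: v_def)
      then have "v k - (\<Sum>i<m. \<psi> i (v k) *\<^sub>R Z i) = t *\<^sub>R (u k - (\<Sum>i<m. \<psi> i (u k) *\<^sub>R Z i))"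
        by (simp add: v_def scaleR_diff_right scaleR_sum_right)
      then show ?thesis by (simp add: \<phi>.scaleR)
    qed
    then show "(\<Sum>k<n. \<bar>\<phi> (u k - (\<Sum>i<m. \<psi> i (u k) *\<^sub>R Z i))\<bar> powr p) \<le> \<epsilon>"
      using res[OF \<phi>, of n] b by (simp add: scale divide_le_cancel)
  qed
qed

section \<open>Real and complex scalars\<close>

text \<open>
  A uniform description of both scalar fields: \<open>J\<close> is the imaginary unit in the complex case and 0
  in the real case. The constant 2 spares the proof that the norm is the usual modulus.
\<close>

lemma scalar_real_part:
  obtains J :: "'k::real_or_complex_field" and re :: "'k \<Rightarrow> real"
  where "norm J \<le> 1" "J = 0 \<or> J * J = - 1" "bounded_linear re" "\<And>z. \<bar>re z\<bar> \<le> 2 * norm z"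
    "re 1 = 1" "re J = 0" "\<And>z. z = re z *\<^sub>R 1 - re (J * z) *\<^sub>R J"
proof -
  consider (real) "\<forall>z::'k. \<exists>a. z = a *\<^sub>R 1"
    | (complex) i :: 'k where "i * i = - 1" "\<forall>z. \<exists>a b. z = a *\<^sub>R 1 + b *\<^sub>R i"
    using real_or_complex[where ?'a = 'k] by blast
  then show ?thesis
  proof cases
    case real
    then obtain re :: "'k \<Rightarrow> real" where re: "\<And>z. z = re z *\<^sub>R 1" by metis
    have unique: "re (a *\<^sub>R 1) = a" for a using re[of "a *\<^sub>R 1"] by simp
    have norm: "\<bar>re z\<bar> = norm z" for z using arg_cong[OF re[of z], of norm] by simp
    have bl: "bounded_linear re"
    proof (rule bounded_linear_intro[of _ 1])
      show "re (x + y) = re x + re y" for x y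
        using unique[of "re x + re y"] re[of x] re[of y] by (metis scaleR_left_distrib)
      show "re (r *\<^sub>R x) = r *\<^sub>R re x" for r x
        using unique[of "r * re x"] re[of x] by (metis scaleR_scaleR real_scaleR_def)
    qed (simp add: norm)
    show ?thesis
      by (rule that[of 0 re]) (use bl norm re unique[of 1] linear_0[OF bounded_linear.linear[OF bl]] in auto)
  next
    case (complex J)
    have "norm J * norm J = 1" using arg_cong[OF complex(1), of norm] by (simp add: norm_mult)
    then have J: "norm J = 1" by (metis abs_norm_cancel real_sqrt_abs2 real_sqrt_one)
    have norm: "\<bar>a\<bar> + \<bar>b\<bar> \<le> 2 * norm (a *\<^sub>R 1 + b *\<^sub>R J)" for a b
    proof (cases "a = 0 \<and> b = 0")
      case False
      have "(a *\<^sub>R 1 + b *\<^sub>R J) * (a *\<^sub>R 1 - b *\<^sub>R J) = (a * a + b * b) *\<^sub>R 1"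
        using complex(1) by (simp add: algebra_simps)
      from arg_cong[OF this, of norm]
      have "norm (a *\<^sub>R 1 + b *\<^sub>R J) * norm (a *\<^sub>R 1 - b *\<^sub>R J) = a * a + b * b"
        by (simp add: norm_mult del: mult_scaleR_left mult_scaleR_right)
      moreover have "norm (a *\<^sub>R 1 - b *\<^sub>R J) \<le> \<bar>a\<bar> + \<bar>b\<bar>"
        using norm_triangle_ineq4[of "a *\<^sub>R 1" "b *\<^sub>R J"] by (simp add: J)
      ultimately have "a * a + b * b \<le> norm (a *\<^sub>R 1 + b *\<^sub>R J) * (\<bar>a\<bar> + \<bar>b\<bar>)"
        by (metis mult_left_mono norm_ge_zero)
      moreover have "(\<bar>a\<bar> + \<bar>b\<bar>) * (\<bar>a\<bar> + \<bar>b\<bar>) \<le> 2 * (a * a + b * b)"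
        using zero_le_square[of "\<bar>a\<bar> - \<bar>b\<bar>"] by (simp add: algebra_simps)
      ultimately have "(\<bar>a\<bar> + \<bar>b\<bar>) * (\<bar>a\<bar> + \<bar>b\<bar>) \<le> (2 * norm (a *\<^sub>R 1 + b *\<^sub>R J)) * (\<bar>a\<bar> + \<bar>b\<bar>)"
        by simp
      moreover have "0 < \<bar>a\<bar> + \<bar>b\<bar>" using False by auto
      ultimately show ?thesis by (meson mult_le_cancel_right_pos)
    qed simp
    obtain re im where ri: "\<And>z. z = re z *\<^sub>R 1 + im z *\<^sub>R J" using complex(2) by metis
    have unique: "re (a *\<^sub>R 1 + b *\<^sub>R J) = a" for a b
    proof -
      define z where "z = a *\<^sub>R 1 + b *\<^sub>R J"
      have "(re z - a) *\<^sub>R 1 + (im z - b) *\<^sub>R J = (re z *\<^sub>R 1 + im z *\<^sub>R J) - z"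
        by (simp add: z_def algebra_simps)
      also have "\<dots> = 0" using ri[of z] by simp
      finally have "\<bar>re z - a\<bar> + \<bar>im z - b\<bar> \<le> 0" using norm[of "re z - a" "im z - b"] by simp
      then show ?thesis by (simp add: z_def)
    qed
    have bound: "\<bar>re z\<bar> \<le> 2 * norm z" for z
      using norm[of "re z" "im z"] ri[of z] by (smt (verit))
    have bl: "bounded_linear re"
    proof (rule bounded_linear_intro[of _ 2])
      show "re (x + y) = re x + re y" for x y
      proof -
        have "x + y = (re x + re y) *\<^sub>R 1 + (im x + im y) *\<^sub>R J"
          by (subst ri[of x], subst ri[of y]) (simp add: algebra_simps)
        then show ?thesis using unique by metis
      qed
      show "re (r *\<^sub>R x) = r *\<^sub>R re x" for r x
      proof -
        have "r *\<^sub>R x = (r * re x) *\<^sub>R 1 + (r * im x) *\<^sub>R J"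
          by (subst ri[of x]) (simp add: algebra_simps)
        then show ?thesis using unique by (metis real_scaleR_def)
      qed
      show "norm (re x) \<le> norm x * 2" for x using bound[of x] by simp
    qed
    have im: "re (J * z) = - im z" for z
    proof -
      have "J * z = (- im z) *\<^sub>R 1 + re z *\<^sub>R J"
        by (subst ri[of z]) (simp add: algebra_simps complex(1))
      then show ?thesis using unique by metis
    qed
    show ?thesis
    proof (rule that[of J re])
      show "re 1 = 1" using unique[of 1 0] by simp
      show "re J = 0" using unique[of 0 1] by simp
      show "z = re z *\<^sub>R 1 - re (J * z) *\<^sub>R J" for z using ri[of z] by (simp add: im)
    qed (use J complex(1) bl bound in auto)
  qed
qed

context banach_over
begin

lemma scale_scaleR_left: "scale (r *\<^sub>R c) x = r *\<^sub>R scale c x"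
  by (metis scaleR_conv_of_real scale_scale scale_of_real)

lemma scale_scaleR_right: "scale c (r *\<^sub>R x) = r *\<^sub>R scale c x"
  by (metis scale_left_commute scale_of_real)

lemma bounded_linear_scale: "bounded_linear (scale c)"
  by (rule bounded_linear_intro[of _ "norm c"])
    (simp_all add: scale_right_distrib scale_scaleR_right norm_scale mult.commute)

lemma bounded_linear_scale_left: "bounded_linear (\<lambda>c. scale c x)"
  by (rule bounded_linear_intro[of _ "norm x"])
    (simp_all add: scale_left_distrib scale_scaleR_left norm_scale)

end

section \<open>Weakly and unconditionally summable sequences\<close>

lemma vector_space_mult: "vector_space ((*) :: 'k::field \<Rightarrow> 'k \<Rightarrow> 'k)"
  by unfold_locales (auto simp: algebra_simps)

lemma bounded_operatorsI:
  assumes "banach_over sX" "vector_space sY" "bounded_linear T" "\<And>c x. T (sX c x) = sY c (T x)"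
  shows "T \<in> bounded_operators sX sY"
proof -
  interpret banach_over sX by fact
  interpret T: bounded_linear T by fact
  show ?thesis unfolding bounded_operators_def
    by (simp add: assms(3) Vector_Spaces.linear_iff assms(2,4) vector_space_axioms T.add)
qed

lemma bounded_operatorsD:
  assumes "T \<in> bounded_operators sX sY"
  shows "bounded_linear T" "T (sX c x) = sY c (T x)"
  using assms by (auto simp: bounded_operators_def Vector_Spaces.linear_iff)

lemma dual_ballI:
  assumes "f \<in> dual_space sX" "\<And>x. norm (f x) \<le> norm x"
  shows "f \<in> dual_ball sX"
proof -
  have "onorm f \<le> 1" by (rule onorm_bound) (use assms(2) in auto)
  then show ?thesis using assms(1) by (simp add: dual_ball_def)
qed

lemma dual_ballD:
  assumes "f \<in> dual_ball sX"
  shows "f \<in> dual_space sX" "bounded_linear f" "f (sX c x) = c * f x" "norm (f x) \<le> norm x"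
proof -
  show f: "f \<in> dual_space sX" using assms by (simp add: dual_ball_def)
  then show bl: "bounded_linear f" and "f (sX c x) = c * f x"
    unfolding dual_space_def by (auto dest: bounded_operatorsD)
  have "norm (f x) \<le> onorm f * norm x" by (rule onorm[OF bl])
  also have "\<dots> \<le> 1 * norm x" using assms by (intro mult_right_mono) (auto simp: dual_ball_def)
  finally show "norm (f x) \<le> norm x" by simp
qed

lemma dual_ball_zero:
  assumes "banach_over sX"
  shows "(\<lambda>_. 0) \<in> dual_ball sX"
  by (rule dual_ballI) (auto simp: dual_space_def intro!: bounded_operatorsI assms vector_space_mult bounded_linear_zero)

lemma weak_norm_upper:
  assumes "x \<in> weakly_summable p sX" "f \<in> dual_ball sX"
  shows "(\<Sum>k. norm (f (x k)) powr p) powr (1 / p) \<le> weak_norm p sX x"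
  unfolding weak_norm_def using assms by (intro cSUP_upper) (auto simp: weakly_summable_def)

lemma weak_norm_nonneg:
  assumes "banach_over sX" "x \<in> weakly_summable p sX"
  shows "0 \<le> weak_norm p sX x"
  using weak_norm_upper[OF assms(2) dual_ball_zero[OF assms(1)]] by (rule order_trans[rotated]) simp

lemma weak_norm_le:
  assumes "banach_over sX"
    "\<And>f. f \<in> dual_ball sX \<Longrightarrow> (\<Sum>k. norm (f (x k)) powr p) powr (1 / p) \<le> C"
  shows "weak_norm p sX x \<le> C"
  unfolding weak_norm_def by (rule cSUP_least) (use dual_ball_zero[OF assms(1)] assms(2) in auto)

lemma weakly_summable_tail:
  assumes p: "0 < p" and x: "x \<in> weakly_summable p sX"
  shows "(\<lambda>k. if k < n then 0 else x k) \<in> weakly_summable p sX"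
proof -
  have zero: "f 0 = 0" if "f \<in> dual_space sX" for f
    using that linear_0[OF bounded_linear.linear] unfolding dual_space_def
    by (metis bounded_operatorsD(1))
  have le: "norm (f (if k < n then 0 else x k)) powr p \<le> norm (f (x k)) powr p"
    if "f \<in> dual_space sX" for f k
    using zero[OF that] by auto
  have s: "summable (\<lambda>k. norm (f (x k)) powr p)" if "f \<in> dual_space sX" for f
    using x that by (simp add: weakly_summable_def)
  have s': "summable (\<lambda>k. norm (f (if k < n then 0 else x k)) powr p)" if "f \<in> dual_space sX" for f
    by (rule summable_comparison_test'[OF s[OF that], of 0]) (use le[OF that] in simp)
  have "bdd_above ((\<lambda>f. (\<Sum>k. norm (f (if k < n then 0 else x k)) powr p) powr (1 / p)) ` dual_ball sX)"
  proof (rule bdd_aboveI2)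
    fix f assume f: "f \<in> dual_ball sX"
    have "(\<Sum>k. norm (f (if k < n then 0 else x k)) powr p) \<le> (\<Sum>k. norm (f (x k)) powr p)"
      using dual_ballD(1)[OF f] by (intro suminf_le le s s')
    then have "(\<Sum>k. norm (f (if k < n then 0 else x k)) powr p) powr (1 / p)
        \<le> (\<Sum>k. norm (f (x k)) powr p) powr (1 / p)"
      using p dual_ballD(1)[OF f] by (intro powr_mono2) (auto intro!: suminf_nonneg s')
    then show "(\<Sum>k. norm (f (if k < n then 0 else x k)) powr p) powr (1 / p) \<le> weak_norm p sX x"
      using weak_norm_upper[OF x f] by simp
  qed
  then show ?thesis using s' by (simp add: weakly_summable_def)
qed

lemma weakly_summable_image:
  fixes sX :: "'k::real_or_complex_field \<Rightarrow> 'x::banach \<Rightarrow> 'x"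
  assumes X: "banach_over sX" and p: "0 < p" and R: "R \<in> bounded_operators sX sX"
    and C: "0 < C" "\<And>y. norm (R y) \<le> C * norm y" and x: "x \<in> weakly_summable p sX"
  shows "(\<lambda>k. R (x k)) \<in> weakly_summable p sX"
    and "weak_norm p sX (\<lambda>k. R (x k)) \<le> C * weak_norm p sX x"
proof -
  have comp: "(\<lambda>y. (1 / C) *\<^sub>R f (R y)) \<in> dual_space sX" if "f \<in> dual_space sX" for f
    unfolding dual_space_def
  proof (rule bounded_operatorsI[OF X vector_space_mult])
    have f: "f \<in> bounded_operators sX (*)" using that by (simp add: dual_space_def)
    show "bounded_linear (\<lambda>y. (1 / C) *\<^sub>R f (R y))"
      by (rule bounded_linear_compose[OF bounded_linear_scaleR_right
            bounded_linear_compose[OF bounded_operatorsD(1)[OF f] bounded_operatorsD(1)[OF R]]])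
    show "(1 / C) *\<^sub>R f (R (sX c y)) = c * ((1 / C) *\<^sub>R f (R y))" for c y
      by (simp add: bounded_operatorsD(2)[OF R] bounded_operatorsD(2)[OF f])
  qed
  have eq: "(\<lambda>k. norm (f (R (x k))) powr p) = (\<lambda>k. C powr p * norm ((1 / C) *\<^sub>R f (R (x k))) powr p)"
    for f :: "'x \<Rightarrow> 'k"
  proof
    fix k
    have "C powr p * norm ((1 / C) *\<^sub>R f (R (x k))) powr p = (C * norm ((1 / C) *\<^sub>R f (R (x k)))) powr p"
      by (rule powr_mult[symmetric])
    also have "C * norm ((1 / C) *\<^sub>R f (R (x k))) = norm (f (R (x k)))" using C(1) by simp
    finally show "norm (f (R (x k))) powr p = C powr p * norm ((1 / C) *\<^sub>R f (R (x k))) powr p"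
      by (rule sym)
  qed
  have s: "summable (\<lambda>k. norm ((1 / C) *\<^sub>R f (R (x k))) powr p)" if "f \<in> dual_space sX" for f
  proof -
    have "\<forall>g\<in>dual_space sX. summable (\<lambda>k. norm (g (x k)) powr p)"
      using x by (simp add: weakly_summable_def)
    from bspec[OF this comp[OF that]] show ?thesis .
  qed
  have s': "summable (\<lambda>k. norm (f (R (x k))) powr p)" if "f \<in> dual_space sX" for f
    by (subst eq) (rule summable_mult[OF s[OF that]])
  have le: "(\<Sum>k. norm (f (R (x k))) powr p) powr (1 / p) \<le> C * weak_norm p sX x"
    if f: "f \<in> dual_ball sX" for f
  proof -
    have "(\<lambda>y. (1 / C) *\<^sub>R f (R y)) \<in> dual_ball sX"
    proof (rule dual_ballI[OF comp[OF dual_ballD(1)[OF f]]])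
      show "norm ((1 / C) *\<^sub>R f (R y)) \<le> norm y" for y
        using order_trans[OF dual_ballD(4)[OF f] C(2)[of y]] C(1) by (simp add: field_simps)
    qed
    from weak_norm_upper[OF x this]
    have *: "(\<Sum>k. norm ((1 / C) *\<^sub>R f (R (x k))) powr p) powr (1 / p) \<le> weak_norm p sX x" .
    have "(\<Sum>k. norm (f (R (x k))) powr p) = C powr p * (\<Sum>k. norm ((1 / C) *\<^sub>R f (R (x k))) powr p)"
      by (subst eq) (rule suminf_mult[OF s[OF dual_ballD(1)[OF f]]])
    also have "\<dots> powr (1 / p) = C * (\<Sum>k. norm ((1 / C) *\<^sub>R f (R (x k))) powr p) powr (1 / p)"
    proof -
      have "(C powr p) powr (1 / p) = C" unfolding powr_powr using C(1) p by simp
      then show ?thesis unfolding powr_mult by simp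
    qed
    also have "\<dots> \<le> C * weak_norm p sX x" using * C by (intro mult_left_mono) auto
    finally show ?thesis .
  qed
  show "(\<lambda>k. R (x k)) \<in> weakly_summable p sX"
    unfolding weakly_summable_def
  proof (intro CollectI conjI ballI)
    show "bdd_above ((\<lambda>f. (\<Sum>k. norm (f (R (x k))) powr p) powr (1 / p)) ` dual_ball sX)"
      by (rule bdd_aboveI2) (rule le)
  qed (rule s')
  show "weak_norm p sX (\<lambda>k. R (x k)) \<le> C * weak_norm p sX x"
    by (rule weak_norm_le[OF X le])
qed

lemma unconditionally_summable_image:
  assumes X: "banach_over sX" and p: "0 < p" and R: "R \<in> bounded_operators sX sX"
    and x: "x \<in> unconditionally_summable p sX"
  shows "(\<lambda>k. R (x k)) \<in> unconditionally_summable p sX"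
proof -
  obtain C where C: "0 < C" "\<And>y. norm (R y) \<le> C * norm y"
    using bounded_linear.pos_bounded[OF bounded_operatorsD(1)[OF R]] by (auto simp: mult.commute)
  have xw: "x \<in> weakly_summable p sX" 
    and lim: "(\<lambda>n. weak_norm p sX (\<lambda>k. if k < n then 0 else x k)) \<longlonglongrightarrow> 0"
    using x by (auto simp: unconditionally_summable_def)
  have "R 0 = 0" by (rule linear_0[OF bounded_linear.linear[OF bounded_operatorsD(1)[OF R]]])
  then have eq: "(\<lambda>k. if k < n then 0 else R (x k)) = (\<lambda>k. R (if k < n then 0 else x k))" for n
    by auto
  note img = weakly_summable_image[OF X p R C weakly_summable_tail[OF p xw]]
  have "(\<lambda>n. weak_norm p sX (\<lambda>k. if k < n then 0 else R (x k))) \<longlonglongrightarrow> 0"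
  proof (rule tendsto_sandwich[of "\<lambda>_. 0" _ _ "\<lambda>n. C * weak_norm p sX (\<lambda>k. if k < n then 0 else x k)"])
    show "(\<lambda>n. C * weak_norm p sX (\<lambda>k. if k < n then 0 else x k)) \<longlonglongrightarrow> 0"
      using tendsto_mult_right_zero[OF lim, of C] by simp
    show "\<forall>\<^sub>F n in sequentially. 0 \<le> weak_norm p sX (\<lambda>k. if k < n then 0 else R (x k))"
      unfolding eq by (intro always_eventually allI weak_norm_nonneg[OF X] img)
    show "\<forall>\<^sub>F n in sequentially. weak_norm p sX (\<lambda>k. if k < n then 0 else R (x k))
        \<le> C * weak_norm p sX (\<lambda>k. if k < n then 0 else x k)"
      unfolding eq by (intro always_eventually allI img)
  qed simp
  then show ?thesis
    using weakly_summable_image(1)[OF X p R C xw] by (simp add: unconditionally_summable_def)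
qed

lemma p_convex_hull_image:
  assumes R: "R \<in> bounded_operators sX sX" and z: "z \<in> p_convex_hull p sX x"
  shows "R z \<in> p_convex_hull p sX (\<lambda>k. R (x k))"
proof -
  obtain c where c: "c \<in> (if p = 1 then c0_ball else ell_ball (dual_exponent p))"
      "(\<lambda>k. sX (c k) (x k)) sums z"
    using z unfolding p_convex_hull_def by blast
  have "(\<lambda>k. R (sX (c k) (x k))) sums R z"
    by (rule bounded_linear.sums[OF bounded_operatorsD(1)[OF R] c(2)])
  then have "(\<lambda>k. sX (c k) (R (x k))) sums R z" by (simp add: bounded_operatorsD(2)[OF R])
  then show ?thesis unfolding p_convex_hull_def using c(1) by blast
qed

lemma sum_even_odd: "(\<Sum>j<2 * n. g j) = (\<Sum>k<n. g (2 * k) + g (2 * k + 1) :: real)" for n :: nat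
  by (induction n) auto

lemma powr_sum4_le:
  fixes a b c d :: real
  assumes "0 < p" "0 \<le> a" "0 \<le> b" "0 \<le> c" "0 \<le> d"
  shows "(a + b + c + d) powr p \<le> 4 powr p * (a powr p + b powr p + c powr p + d powr p)"
proof -
  define M where "M = max (max a b) (max c d)"
  have "(a + b + c + d) powr p \<le> (4 * M) powr p"
    using assms by (intro powr_mono2) (auto simp: M_def)
  also have "\<dots> = 4 powr p * M powr p" using assms by (intro powr_mult)
  also have "M powr p \<le> a powr p + b powr p + c powr p + d powr p"
    by (auto simp: M_def max_def)
  finally show ?thesis by simp
qed

section \<open>The approximation property\<close>

text \<open>
  The passage from real to arbitrary scalars. The real result is applied to the sequence that
  interleaves \<open>x\<^sub>k\<close> and \<open>J x\<^sub>k\<close>, and each real functional \<open>\<psi>\<close> is replaced by \<open>F \<psi> = \<psi> - \<psi> (J \<cdot>) J\<close>, which is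
  linear over the scalars. In the complex case \<open>y - J (J y) = 2 y\<close>, whence the factor \<open>\<theta>\<close>.
  The error at \<open>x\<^sub>k\<close> is then a combination of the real errors at \<open>x\<^sub>k\<close> and \<open>J x\<^sub>k\<close>.
\<close>

lemma weakly_summable_finite_rank_approximation:
  fixes sX :: "'k::real_or_complex_field \<Rightarrow> 'x::banach \<Rightarrow> 'x"
  assumes X: "banach_over sX" and cotype: "has_cotype TYPE('x) 2" and p: "1 \<le> p" "p < 2"
    and x: "x \<in> weakly_summable p sX" and e: "0 < e"
  obtains A where "A \<in> finite_rank_operators sX sX" "weak_norm p sX (\<lambda>k. x k - A (x k)) < e"
proof -
  interpret banach_over sX by (rule X)
  obtain J :: 'k and re :: "'k \<Rightarrow> real"
    where J: "norm J \<le> 1" "J = 0 \<or> J * J = - 1" and re: "bounded_linear re" "\<And>z. \<bar>re z\<bar> \<le> 2 * norm z"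
      "re 1 = 1" "re J = 0" and split: "\<And>z. z = re z *\<^sub>R 1 - re (J * z) *\<^sub>R J"
    by (rule scalar_real_part) blast
  interpret re: bounded_linear re by (rule re(1))
  have sJ: "norm (sX J y) \<le> norm y" for y
    using mult_right_mono[OF J(1), of "norm y"] by (simp add: norm_scale)
  have sJJ: "J = 0 \<or> sX J (sX J y) = - y" for y
    using J(2) by auto
  interpret sJ: bounded_linear "sX J" by (rule bounded_linear_scale)
  define F where "F \<psi> y = \<psi> y *\<^sub>R 1 - \<psi> (sX J y) *\<^sub>R J" for \<psi> :: "'x \<Rightarrow> real" and y
  have F_bl: "bounded_linear (F \<psi>)" if "bounded_linear \<psi>" for \<psi>
    unfolding F_def[abs_def]
    by (intro bounded_linear_sub bounded_linear_compose[OF bounded_linear_scaleR_left])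
      (use that bounded_linear_compose[OF that bounded_linear_scale] in auto)
  have F_J: "F \<psi> (sX J y) = J * F \<psi> y" if "bounded_linear \<psi>" for \<psi> y
  proof -
    interpret \<psi>: bounded_linear \<psi> by (rule that)
    from J(2) show ?thesis
    proof
      assume "J = 0"
      then show ?thesis by (simp add: F_def \<psi>.zero)
    next
      assume JJ: "J * J = - 1"
      then have "sX J (sX J y) = - y" by simp
      then show ?thesis by (simp add: F_def JJ right_diff_distrib \<psi>.neg)
    qed
  qed
  have F_scale: "F \<psi> (sX c y) = c * F \<psi> y" if \<psi>: "bounded_linear \<psi>" for \<psi> c y
  proof -
    interpret F: bounded_linear "F \<psi>" by (rule F_bl[OF \<psi>])
    have "sX c y = re c *\<^sub>R y - re (J * c) *\<^sub>R sX J y"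
      by (subst split[of c]) (simp add: scale_left_diff_distrib scale_scaleR_left)
    then have "F \<psi> (sX c y) = re c *\<^sub>R F \<psi> y - re (J * c) *\<^sub>R (J * F \<psi> y)"
      by (simp add: F.diff F.scaleR F_J[OF \<psi>])
    also have "\<dots> = (re c *\<^sub>R 1 - re (J * c) *\<^sub>R J) * F \<psi> y" by (simp add: algebra_simps)
    finally show ?thesis unfolding split[of c, symmetric] .
  qed
  have re_F: "re (F \<psi> y) = \<psi> y" for \<psi> y
    by (simp add: F_def re.diff re.scaleR re(3,4))

  define u where "u j = (if even j then x (j div 2) else sX J (x (j div 2)))" for j
  define M where "M = weak_norm p sX x"
  have weak_u: "(\<Sum>j<n. \<bar>\<phi> (u j)\<bar> powr p) \<le> 2 * (4 powr p * M powr p)"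
    if \<phi>: "bounded_linear \<phi>" "\<And>y. \<bar>\<phi> y\<bar> \<le> norm y" for \<phi> and n :: nat
  proof -
    define g where "g y = (1 / 2) *\<^sub>R F \<phi> y" for y
    have g: "g \<in> dual_ball sX"
    proof (rule dual_ballI)
      show "g \<in> dual_space sX"
        unfolding dual_space_def g_def[abs_def]
        by (rule bounded_operatorsI[OF X vector_space_mult bounded_linear_compose[OF bounded_linear_scaleR_right F_bl[OF \<phi>(1)]]])
          (simp add: F_scale[OF \<phi>(1)])
      show "norm (g y) \<le> norm y" for y
      proof -
        have "norm (F \<phi> y) \<le> norm (\<phi> y *\<^sub>R (1 :: 'k)) + norm (\<phi> (sX J y) *\<^sub>R J)"
          unfolding F_def by (rule norm_triangle_ineq4)
        also have "\<dots> \<le> norm y + norm y * 1"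
        proof (rule add_mono)
          show "norm (\<phi> y *\<^sub>R (1 :: 'k)) \<le> norm y" using \<phi>(2)[of y] by simp
          show "norm (\<phi> (sX J y) *\<^sub>R J) \<le> norm y * 1"
            unfolding norm_scaleR using order_trans[OF \<phi>(2)[of "sX J y"] sJ[of y]] J(1)
            by (intro mult_mono) auto
        qed
        finally show ?thesis by (simp add: g_def)
      qed
    qed
    have \<phi>_le: "\<bar>\<phi> y\<bar> \<le> 4 * norm (g y)" for y
      using re(2)[of "F \<phi> y"] by (simp add: re_F g_def)
    have u_le: "\<bar>\<phi> (u j)\<bar> \<le> 4 * norm (g (x (j div 2)))" for j
    proof -
      have "norm (g (u j)) \<le> norm (g (x (j div 2)))"
        using dual_ballD(3)[OF g, of J "x (j div 2)"] mult_right_mono[OF J(1), of "norm (g (x (j div 2)))"]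
        by (simp add: u_def norm_mult)
      then show ?thesis using \<phi>_le[of "u j"] by simp
    qed
    have s: "summable (\<lambda>k. norm (g (x k)) powr p)"
      using x dual_ballD(1)[OF g] by (simp add: weakly_summable_def)
    have "(\<Sum>k. norm (g (x k)) powr p) = ((\<Sum>k. norm (g (x k)) powr p) powr (1 / p)) powr p"
      unfolding powr_powr using p suminf_nonneg[OF s] by simp
    also have "\<dots> \<le> M powr p"
      unfolding M_def using p weak_norm_upper[OF x g] by (intro powr_mono2) auto
    finally have suminf_le: "(\<Sum>k. norm (g (x k)) powr p) \<le> M powr p" .
    have "(\<Sum>j<n. \<bar>\<phi> (u j)\<bar> powr p) \<le> (\<Sum>j<2 * n. \<bar>\<phi> (u j)\<bar> powr p)"
      by (rule sum_mono2) auto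
    also have "\<dots> \<le> (\<Sum>j<2 * n. (4 * norm (g (x (j div 2)))) powr p)"
      using p u_le by (intro sum_mono powr_mono2) auto
    also have "\<dots> = (\<Sum>k<n. 2 * (4 powr p * norm (g (x k)) powr p))"
      unfolding sum_even_odd by (intro sum.cong refl) (simp add: powr_mult)
    also have "\<dots> = 2 * (4 powr p * (\<Sum>k<n. norm (g (x k)) powr p))"
      by (simp add: sum_distrib_left)
    also have "\<dots> \<le> 2 * (4 powr p * M powr p)"
      using order_trans[OF sum_le_suminf[OF s, of "{..<n}"] suminf_le] by simp
    finally show ?thesis .
  qed
  define \<epsilon> where "\<epsilon> = (e / 2) powr p / (2 * 8 powr p)"
  have \<epsilon>: "0 < \<epsilon>" using e by (simp add: \<epsilon>_def)
  obtain m and \<psi> :: "nat \<Rightarrow> 'x \<Rightarrow> real" and Z where \<psi>: "\<And>i. i < m \<Longrightarrow> bounded_linear (\<psi> i)"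
    and approx: "\<And>\<phi> n. bounded_linear \<phi> \<Longrightarrow> (\<And>y. \<bar>\<phi> y\<bar> \<le> norm y) \<Longrightarrow>
           (\<Sum>j<n. \<bar>\<phi> (u j - (\<Sum>i<m. \<psi> i (u j) *\<^sub>R Z i))\<bar> powr p) \<le> \<epsilon>"
  proof (rule cotype_2_finite_rank_approximation[OF cotype p _ \<epsilon>, of u])
    show "(\<Sum>j<n. \<bar>\<phi> (u j)\<bar> powr p) \<le> 2 * (4 powr p * M powr p)"
      if "bounded_linear \<phi>" "\<And>y. \<bar>\<phi> y\<bar> \<le> norm y" for \<phi> and n :: nat
      using that by (rule weak_u)
  qed blast
  define \<theta> :: real where "\<theta> = (if J = 0 then 1 else 1 / 2)"
  define A where "A y = \<theta> *\<^sub>R (\<Sum>i<m. sX (F (\<psi> i) y) (Z i))" for y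
  define D where "D j = u j - (\<Sum>i<m. \<psi> i (u j) *\<^sub>R Z i)" for j
  have A_bl: "bounded_linear A"
    unfolding A_def[abs_def]
    by (intro bounded_linear_compose[OF bounded_linear_scaleR_right] bounded_linear_sum
        bounded_linear_compose[OF bounded_linear_scale_left F_bl] \<psi>) auto
  have A: "A \<in> finite_rank_operators sX sX"
    unfolding finite_rank_operators_def
  proof (intro CollectI conjI exI)
    show "A \<in> bounded_operators sX sX"
    proof (rule bounded_operatorsI[OF X vector_space_axioms A_bl])
      show "A (sX c y) = sX c (A y)" for c y
        by (simp add: A_def F_scale[OF \<psi>] scale_sum_right scale_scaleR_right)
    qed
    show "finite (Z ` {..<m})" by simp
    show "range A \<subseteq> module.span sX (Z ` {..<m})"
    proof (intro image_subsetI)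
      fix y
      have "sX (of_real \<theta>) (\<Sum>i<m. sX (F (\<psi> i) y) (Z i)) \<in> span (Z ` {..<m})"
        by (intro span_scale span_sum span_base) auto
      then show "A y \<in> module.span sX (Z ` {..<m})" by (simp add: A_def scale_of_real)
    qed
  qed
  have diff: "x k - A (x k) = \<theta> *\<^sub>R (D (2 * k) - sX J (D (2 * k + 1)))" for k
  proof -
    have "\<theta> *\<^sub>R (x k - sX J (sX J (x k))) = x k"
    proof (cases "J = 0")
      case False
      then have "x k - sX J (sX J (x k)) = 2 *\<^sub>R x k" using sJJ[of "x k"] by (simp add: scaleR_2)
      then show ?thesis using False by (simp add: \<theta>_def)
    qed (simp add: \<theta>_def)
    moreover have "A (x k) = \<theta> *\<^sub>R ((\<Sum>i<m. \<psi> i (x k) *\<^sub>R Z i) - sX J (\<Sum>i<m. \<psi> i (sX J (x k)) *\<^sub>R Z i))"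
      by (simp add: A_def F_def scale_left_diff_distrib scale_scaleR_left scale_scaleR_right
          sum_subtractf scale_sum_right)
    ultimately show ?thesis
      by (simp add: D_def u_def sJ.diff algebra_simps)
  qed
  have "(\<Sum>k. norm (f (x k - A (x k))) powr p) powr (1 / p) \<le> e / 2" if f: "f \<in> dual_ball sX" for f
  proof -
    interpret f: bounded_linear f by (rule dual_ballD(2)[OF f])
    \<comment> \<open>Up to sign the real and imaginary parts of \<open>f\<close>, halved so that they have norm at most 1.\<close>
    define \<phi> where "\<phi> y = (1 / 2) * re (f y)" for y
    define \<phi>' where "\<phi>' y = (1 / 2) * re (J * f y)" for y
    have \<phi>: "bounded_linear \<phi>" "\<bar>\<phi> y\<bar> \<le> norm y" for y
    proof -
      show "bounded_linear \<phi>" unfolding \<phi>_def[abs_def]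
        by (intro bounded_linear_const_mult bounded_linear_compose[OF re(1)] f.bounded_linear_axioms)
      show "\<bar>\<phi> y\<bar> \<le> norm y"
        using re(2)[of "f y"] dual_ballD(4)[OF f, of y] by (simp add: \<phi>_def abs_mult)
    qed
    have \<phi>': "bounded_linear \<phi>'" "\<bar>\<phi>' y\<bar> \<le> norm y" for y
    proof -
      show "bounded_linear \<phi>'" unfolding \<phi>'_def[abs_def]
        by (intro bounded_linear_const_mult bounded_linear_compose[OF re(1)] f.bounded_linear_axioms)
      have "norm (J * f y) \<le> norm y"
        using mult_mono[OF J(1) dual_ballD(4)[OF f, of y]] by (simp add: norm_mult)
      then show "\<bar>\<phi>' y\<bar> \<le> norm y" using re(2)[of "J * f y"] by (simp add: \<phi>'_def abs_mult)
    qed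
    have f_le: "norm (f v) \<le> 2 * (\<bar>\<phi> v\<bar> + \<bar>\<phi>' v\<bar>)" for v
    proof -
      have "norm (re (f v) *\<^sub>R 1 - re (J * f v) *\<^sub>R J)
          \<le> norm (re (f v) *\<^sub>R (1 :: 'k)) + norm (re (J * f v) *\<^sub>R J)"
        by (rule norm_triangle_ineq4)
      then have "norm (f v) \<le> norm (re (f v) *\<^sub>R (1 :: 'k)) + norm (re (J * f v) *\<^sub>R J)"
        unfolding split[of "f v", symmetric] .
      also have "\<dots> \<le> \<bar>re (f v)\<bar> + \<bar>re (J * f v)\<bar> * 1"
        unfolding norm_scaleR using J(1) by (intro add_mono mult_left_mono) auto
      finally show ?thesis by (simp add: \<phi>_def \<phi>'_def abs_mult)
    qed
    define a where "a j = \<bar>\<phi> (D j)\<bar>" for j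
    define b where "b j = \<bar>\<phi>' (D j)\<bar>" for j
    have term_le: "norm (f (x k - A (x k))) powr p
        \<le> 8 powr p * ((a (2 * k) powr p + a (2 * k + 1) powr p) + (b (2 * k) powr p + b (2 * k + 1) powr p))" for k
    proof -
      have "norm (f (x k - A (x k))) = \<theta> * norm (f (D (2 * k)) - J * f (D (2 * k + 1)))"
        unfolding diff using dual_ballD(3)[OF f]
        by (simp add: f.scaleR f.diff \<theta>_def)
      also have "\<dots> \<le> 1 * (norm (f (D (2 * k))) + norm (f (D (2 * k + 1))))"
      proof (intro mult_mono)
        have "norm (J * f (D (2 * k + 1))) \<le> norm (f (D (2 * k + 1)))"
          using mult_right_mono[OF J(1), of "norm (f (D (2 * k + 1)))"] by (simp add: norm_mult)
        then show "norm (f (D (2 * k)) - J * f (D (2 * k + 1))) \<le> norm (f (D (2 * k))) + norm (f (D (2 * k + 1)))"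
          using norm_triangle_ineq4[of "f (D (2 * k))" "J * f (D (2 * k + 1))"] by simp
      qed (auto simp: \<theta>_def)
      also have "\<dots> \<le> 2 * (a (2 * k) + a (2 * k + 1) + b (2 * k) + b (2 * k + 1))"
        using f_le[of "D (2 * k)"] f_le[of "D (2 * k + 1)"] by (simp add: a_def b_def)
      finally have "norm (f (x k - A (x k))) powr p
          \<le> (2 * (a (2 * k) + a (2 * k + 1) + b (2 * k) + b (2 * k + 1))) powr p"
        using p by (intro powr_mono2) auto
      also have "\<dots> = 2 powr p * (a (2 * k) + a (2 * k + 1) + b (2 * k) + b (2 * k + 1)) powr p"
        by (rule powr_mult)
      also have "\<dots> \<le> 2 powr p * (4 powr p * (a (2 * k) powr p + a (2 * k + 1) powr p + b (2 * k) powr p + b (2 * k + 1) powr p))"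
        using p by (intro mult_left_mono powr_sum4_le) (auto simp: a_def b_def)
      also have "2 powr p * (4 powr p * y) = 8 powr p * y" for y
        using powr_mult[of 2 4 p] by simp
      finally show ?thesis by (simp add: add.assoc)
    qed
    have partial: "(\<Sum>k<n. norm (f (x k - A (x k))) powr p) \<le> (e / 2) powr p" for n
    proof -
      have "(\<Sum>k<n. norm (f (x k - A (x k))) powr p)
          \<le> (\<Sum>k<n. 8 powr p * ((a (2 * k) powr p + a (2 * k + 1) powr p) + (b (2 * k) powr p + b (2 * k + 1) powr p)))"
        by (intro sum_mono term_le)
      also have "\<dots> = 8 powr p * ((\<Sum>j<2 * n. a j powr p) + (\<Sum>j<2 * n. b j powr p))"
        unfolding sum_even_odd by (simp add: sum_distrib_left[symmetric] sum.distrib)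
      also have "\<dots> \<le> 8 powr p * (\<epsilon> + \<epsilon>)"
        unfolding a_def b_def D_def using approx[OF \<phi>] approx[OF \<phi>']
        by (intro mult_left_mono add_mono) auto
      also have "\<dots> = (e / 2) powr p" by (simp add: \<epsilon>_def)
      finally show ?thesis .
    qed
    have s: "summable (\<lambda>k. norm (f (x k - A (x k))) powr p)"
      by (rule summableI_nonneg_bounded[OF _ partial]) simp
    have "(\<Sum>k. norm (f (x k - A (x k))) powr p) \<le> (e / 2) powr p"
      by (rule suminf_le_const[OF s partial])
    then have "(\<Sum>k. norm (f (x k - A (x k))) powr p) powr (1 / p) \<le> ((e / 2) powr p) powr (1 / p)"
      using p suminf_nonneg[OF s] by (intro powr_mono2) auto
    also have "\<dots> = e / 2" unfolding powr_powr using p e by simp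
    finally show ?thesis .
  qed
  then have "weak_norm p sX (\<lambda>k. x k - A (x k)) \<le> e / 2" by (rule weak_norm_le[OF X])
  then show ?thesis using that[OF A] e by simp
qed

text \<open>
  If \<open>(x\<^sub>k)\<close> witnesses that \<open>T\<close> is unconditionally \<open>p\<close>-compact and \<open>A\<close> is an operator on \<open>X\<close>, then
  \<open>(x\<^sub>k - A x\<^sub>k)\<close> is a witness for \<open>T - A T\<close>. So \<open>T\<close> enters only through \<open>(x\<^sub>k)\<close>, and \<open>A T\<close> is the required
  approximation.
\<close>

theorem theorem3p3:
  fixes sX :: "'k::real_or_complex_field \<Rightarrow> 'x::banach \<Rightarrow> 'x"
    and p :: real
  assumes "banach_over sX"
    and "has_cotype TYPE('x) 2"
    and "1 \<le> p" and "p < 2"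
  shows "has_Kup_AP TYPE('y::banach) p sX"
  unfolding has_Kup_AP_def
proof (intro allI impI ballI)
  fix sY :: "'k \<Rightarrow> 'y \<Rightarrow> 'y" and T and e :: real
  assume Y: "banach_over sY" and T: "T \<in> Kup p sY sX" and e: "0 < e"
  interpret X: banach_over sX by (rule assms(1))
  have p0: "0 < p" using assms(3) by simp
  have T_op: "T \<in> bounded_operators sY sX" using T by (simp add: Kup_def)
  obtain x where x: "x \<in> unconditionally_summable p sX"
    and hull: "T ` cball 0 1 \<subseteq> p_convex_hull p sX x"
    using T by (auto simp: Kup_def Kup_witnesses_def)
  have xw: "x \<in> weakly_summable p sX" using x by (simp add: unconditionally_summable_def)
  obtain A where A: "A \<in> finite_rank_operators sX sX" and small: "weak_norm p sX (\<lambda>k. x k - A (x k)) < e"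
    using weakly_summable_finite_rank_approximation[OF assms(1,2,3,4) xw e] by blast
  have A_op: "A \<in> bounded_operators sX sX" using A by (simp add: finite_rank_operators_def)
  note A_bl = bounded_operatorsD(1)[OF A_op] and T_bl = bounded_operatorsD(1)[OF T_op]
  define R where "R v = v - A v" for v
  have R: "R \<in> bounded_operators sX sX"
  proof (rule bounded_operatorsI[OF assms(1) X.vector_space_axioms])
    show "bounded_linear R" unfolding R_def[abs_def] by (rule bounded_linear_sub[OF bounded_linear_ident A_bl])
    show "R (sX c v) = sX c (R v)" for c v
      by (simp add: R_def bounded_operatorsD(2)[OF A_op] X.scale_right_diff_distrib)
  qed
  have AT: "(\<lambda>y. A (T y)) \<in> finite_rank_operators sY sX"
  proof -
    have "(\<lambda>y. A (T y)) \<in> bounded_operators sY sX"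
      by (rule bounded_operatorsI[OF Y X.vector_space_axioms bounded_linear_compose[OF A_bl T_bl]])
        (simp add: bounded_operatorsD(2)[OF A_op] bounded_operatorsD(2)[OF T_op])
    moreover obtain B where "finite B" "range A \<subseteq> module.span sX B"
      using A by (auto simp: finite_rank_operators_def)
    ultimately show ?thesis unfolding finite_rank_operators_def by blast
  qed
  have diff_op: "(\<lambda>y. T y - A (T y)) \<in> bounded_operators sY sX"
  proof (rule bounded_operatorsI[OF Y X.vector_space_axioms])
    show "bounded_linear (\<lambda>y. T y - A (T y))"
      by (rule bounded_linear_sub[OF T_bl bounded_linear_compose[OF A_bl T_bl]])
    show "T (sY c y) - A (T (sY c y)) = sX c (T y - A (T y))" for c y
      by (simp add: bounded_operatorsD(2)[OF A_op] bounded_operatorsD(2)[OF T_op] X.scale_right_diff_distrib)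
  qed
  have wit: "(\<lambda>k. R (x k)) \<in> Kup_witnesses p sY sX (\<lambda>y. T y - A (T y))"
    unfolding Kup_witnesses_def
  proof (intro CollectI conjI image_subsetI)
    show "(\<lambda>k. R (x k)) \<in> unconditionally_summable p sX"
      by (rule unconditionally_summable_image[OF assms(1) p0 R x])
    fix y :: 'y assume "y \<in> cball 0 1"
    then have "T y \<in> p_convex_hull p sX x" using hull by blast
    from p_convex_hull_image[OF R this]
    show "T y - A (T y) \<in> p_convex_hull p sX (\<lambda>k. R (x k))" by (simp add: R_def)
  qed
  have "Kup_norm p sY sX (\<lambda>y. T y - A (T y)) \<le> weak_norm p sX (\<lambda>k. R (x k))"
    unfolding Kup_norm_def
  proof (rule cINF_lower[OF _ wit])
    show "bdd_below (weak_norm p sX ` Kup_witnesses p sY sX (\<lambda>y. T y - A (T y)))"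
      by (rule bdd_belowI2[of _ 0])
        (auto simp: Kup_witnesses_def unconditionally_summable_def intro: weak_norm_nonneg[OF assms(1)])
  qed
  then have "Kup_norm p sY sX (\<lambda>y. T y - A (T y)) < e" using small by (simp add: R_def)
  moreover have "(\<lambda>y. T y - A (T y)) \<in> Kup p sY sX"
    using diff_op wit by (auto simp: Kup_def)
  ultimately show "\<exists>S\<in>finite_rank_operators sY sX.
      (\<lambda>y. T y - S y) \<in> Kup p sY sX \<and> Kup_norm p sY sX (\<lambda>y. T y - S y) < e"
    by (intro bexI[OF _ AT] conjI)
qed

end
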